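(* Let $\mathsf{K}$ be a (strict) 2-category. Let $(T,\mu,\eta,\ell,r,a)$ and $(T',\mu',\eta',\ell',r',a')$ be pseudomonads on $\mathsf{K}$, and let $(\lambda,u,m)$ be a pseudomorphism of monads from $T$ to $T'$. Each $T'$-pseudoalgebra $(A,e',\iota',\gamma')$ defines canonically a $T$-pseudoalgebra structure on $A$ with the following structure 1- and 2-cells (whiskerings suppressed): $$e:=e'\circ\lambda_A:\;TA\xrightarrow{\lambda_A}T'A\xrightarrow{e'}A;$$ $$\iota:\; e'\circ\lambda_A\circ\eta_A\xRightarrow{\;u_A^{-1}\;}e'\circ\eta'_A\xRightarrow{\;\iota'\;}\mathrm{id}_A;$$ $$\gamma:\; e'\circ\lambda_A\circ Te'\circ T\lambda_A\xRightarrow{\;\lambda_{e'}\;}e'\circ T'e'\circ\lambda_{T'A}\circ T\lambda_A\xRightarrow{\;\gamma'\;}e'\circ\mu'_A\circ\lambda_{T'A}\circ T\lambda_A\xRightarrow{\;m_A\;}e'\circ\lambda_A\circ\mu_A.$$ Moreover, this construction defines a 2-functor between the categories of pseudoalgebras $\lambda^*:\mathsf{K}^{T'}\to\mathsf{K}^{T}$.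
   Context: Conventions. For a pseudonatural transformation $\alpha:S\Rightarrow T$ and $f:X\to Y$, the (invertible) structure 2-cell is $\alpha_f:\alpha_Y\circ Sf\Rightarrow Tf\circ\alpha_X$. For a pseudofunctor $T$, $\kappa:Tg\circ Tf\Rightarrow T(g\circ f)$ is the compositor and $\upsilon:\mathrm{id}\Rightarrow T\mathrm{id}$ the unitor. Juxtaposition denotes whiskering. Pseudomonad. A pseudomonad $(T,\mu,\eta,\ell,r,a)$ on $\mathsf{K}$ is a pseudofunctor $T:\mathsf{K}\to\mathsf{K}$, pseudonatural transformations $\eta:\mathrm{id}\Rightarrow T$, $\mu:TT\Rightarrow T$, and invertible modifications $\ell:\mu\circ\eta T\Rrightarrow\mathrm{id}_T$, $r:\mathrm{id}_T\Rrightarrow\mu\circ T\eta$, $a:\mu\circ T\mu\Rrightarrow\mu\circ\mu T$ such that (unit) $a(T\eta T)=(\mu\,(rT))\circ(\mu\,\widehat{T\ell})$ as modifications $\mu\circ T\mu\circ T\eta T\Rrightarrow\mu\circ\mu T\circ T\eta T$; (pentagon) $(\mu(aT))\circ(a(T\mu T))\circ(\mu\,\widehat{Ta})=(a(\mu TT))\circ(\mu(\mu_\mu))\circ(a(TT\mu))$ as modifications $\mu\circ T\mu\circ TT\mu\Rrightarrow\mu\circ\mu T\circ\mu TT$; where $\widehat{T\ell}=\upsilon^{-1}\circ T\ell\circ\kappa$, $\widehat{Ta}=\kappa^{-1}\circ Ta\circ\kappa$, and $\mu_\mu$ has components the pseudonaturality cells $\mu_{TX}\circ TT\mu_X\Rightarrow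 T\mu_X\circ\mu_{TTX}$. Pseudomorphism of pseudomonads. $(\lambda,u,m):T\to T'$ consists of a pseudonatural transformation $\lambda:T\Rightarrow T'$ and invertible modifications $u:\eta'\Rrightarrow\lambda\circ\eta$ and $m:\mu'\circ\lambda\lambda\Rrightarrow\lambda\circ\mu$, where $\lambda\lambda:=(\lambda T')\circ(T\lambda)$ (and $\lambda\lambda\lambda:=(\lambda T'T')\circ(T\lambda T')\circ(TT\lambda)$), such that (left unit) $\ell'\lambda=(\lambda\,\ell)\circ(m(\eta T))\circ(\mu'\,\widehat{uT'\eta})$ as modifications $\mu'\circ\eta'T'\circ\lambda\Rrightarrow\lambda$, with $\widehat{uT'\eta}=(\lambda T'\,\eta_\lambda)\circ(uT'\,\lambda)$; (right unit) $\lambda\,r=(m(T\eta))\circ(\mu'\,\widehat{Tu\lambda})\circ(r'\lambda)$ as modifications $\lambda\Rrightarrow\lambda\circ\mu\circ T\eta$, with $\widehat{Tu\lambda}=(\lambda T'(\kappa^{-1}\circ Tu))\circ\lambda_{\eta'}^{-1}$; (associativity) $(\lambda a)\circ(m(T\mu))\circ(\mu'\,\widehat{Tm\lambda})=(m(\mu T))\circ(\mu'\,\widehat{mT'\mu})\circ(a'(\lambda\lambda\lambda))$ as modifications $\mu'\circ T'\mu'\circ\lambda\lambda\lambda\Rrightarrow\lambda\circ\mu\circ\mu T$, with $\widehat{mT'\mu}=(\lambda T'\,\mu_\lambda)\circ(mT'\,(TT\lambda))$ and $\widehat{Tm\lambda}$ the composite of $\lambda_{\mu'}^{-1}$ (whiskered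 with $T\lambda T'\circ TT\lambda$) followed by $\lambda T'$ whiskered with $\kappa^{-1}\circ Tm\circ(\text{compositors }\kappa)$. Pseudoalgebra. A $T$-pseudoalgebra $(A,e,\iota,\gamma)$ is an object $A$, a 1-cell $e:TA\to A$ and invertible 2-cells $\iota:e\circ\eta_A\Rightarrow\mathrm{id}_A$, $\gamma:e\circ Te\Rightarrow e\circ\mu_A$ such that $\gamma(T\eta_A)=(e\,r_A)\circ(e\,\widehat{T\iota})$ and $(e\,a_A)\circ(\gamma(T\mu_A))\circ(e\,\widehat{T\gamma})=(\gamma\,\mu_{TA})\circ(e\,\mu_e)\circ(\gamma(TTe))$, with $\widehat{T\iota}=\upsilon^{-1}\circ T\iota\circ\kappa$, $\widehat{T\gamma}=\kappa^{-1}\circ T\gamma\circ\kappa$. Morphisms and 2-cells of pseudoalgebras. A (strong) morphism $(f,\phi):(A,e_A,\iota_A,\gamma_A)\to(B,e_B,\iota_B,\gamma_B)$ is a 1-cell $f:A\to B$ with an invertible 2-cell $\phi:e_B\circ Tf\Rightarrow f\circ e_A$ such that $\iota_Bf=(f\iota_A)\circ(\phi\,\eta_A)\circ(e_B\,\eta_f)$ and $(f\gamma_A)\circ(\phi(Te_A))\circ(e_B\widehat{T\phi})=(\phi\,\mu_A)\circ(e_B\,\mu_f)\circ(\gamma_B(TTf))$, with $\widehat{T\phi}=\kappa^{-1}\circ T\phi\circ\kappa$. A 2-cell $(f,\phi)\Rightarrow(g,\chi)$ is a 2-cell $\alpha:f\Rightarrow g$ with $(\alpha\,e_A)\circ\phi=\chi\circ(e_B\,T\alpha)$.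 $\mathsf{K}^T$ denotes the 2-category of $T$-pseudoalgebras, strong morphisms and 2-cells. *)

theory Defs
  imports Main
begin

section \<open>Strict 2-categories\<close>

text \<open>A 2-category is given by sets of objects, 1-cells and 2-cells with globular sources and
  targets. Composition is written in functional order: \<open>g \<odot> f\<close> is \<open>g\<close> after \<open>f\<close>,
  \<open>\<beta> \<bullet> \<alpha>\<close> is vertical and \<open>\<beta> \<star> \<alpha>\<close> horizontal composition. The operations are total
  functions whose values are only constrained on composable cells.\<close>

record ('o, 'm, 'c) two_cat =
  Obj :: "'o set"
  Arr :: "'m set"
  Cell :: "'c set"
  Src :: "'m \<Rightarrow> 'o"
  Tgt :: "'m \<Rightarrow> 'o"
  Dom :: "'c \<Rightarrow> 'm"
  Cod :: "'c \<Rightarrow> 'm"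
  Id1 :: "'o \<Rightarrow> 'm"
  Comp1 :: "'m \<Rightarrow> 'm \<Rightarrow> 'm"  (infixr \<open>\<odot>\<index>\<close> 75)
  Id2 :: "'m \<Rightarrow> 'c"
  VComp :: "'c \<Rightarrow> 'c \<Rightarrow> 'c"  (infixr \<open>\<bullet>\<index>\<close> 60)
  HComp :: "'c \<Rightarrow> 'c \<Rightarrow> 'c"  (infixr \<open>\<star>\<index>\<close> 70)

definition hom1 :: "('o, 'm, 'c) two_cat \<Rightarrow> 'o \<Rightarrow> 'o \<Rightarrow> 'm set" where
  "hom1 K A B = {f \<in> Arr K. Src K f = A \<and> Tgt K f = B}"

definition hom2 :: "('o, 'm, 'c) two_cat \<Rightarrow> 'm \<Rightarrow> 'm \<Rightarrow> 'c set" where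
  "hom2 K f g = {\<alpha> \<in> Cell K. Dom K \<alpha> = f \<and> Cod K \<alpha> = g}"

definition inverse2 :: "('o, 'm, 'c) two_cat \<Rightarrow> 'c \<Rightarrow> 'c \<Rightarrow> bool" where
  "inverse2 K \<alpha> \<beta> \<longleftrightarrow> \<beta> \<in> hom2 K (Cod K \<alpha>) (Dom K \<alpha>) \<and>
     \<beta> \<bullet>\<^bsub>K\<^esub> \<alpha> = Id2 K (Dom K \<alpha>) \<and> \<alpha> \<bullet>\<^bsub>K\<^esub> \<beta> = Id2 K (Cod K \<alpha>)"

definition iso2 :: "('o, 'm, 'c) two_cat \<Rightarrow> 'm \<Rightarrow> 'm \<Rightarrow> 'c set" where
  "iso2 K f g = {\<alpha> \<in> hom2 K f g. \<exists>\<beta>. inverse2 K \<alpha> \<beta>}"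

definition inv2 :: "('o, 'm, 'c) two_cat \<Rightarrow> 'c \<Rightarrow> 'c"  (\<open>inv2\<index> _\<close> [81] 80) where
  "inv2\<^bsub>K\<^esub> \<alpha> = (THE \<beta>. inverse2 K \<alpha> \<beta>)"

definition whisker_left :: "('o, 'm, 'c) two_cat \<Rightarrow> 'm \<Rightarrow> 'c \<Rightarrow> 'c"  (infixr \<open>\<lhd>\<index>\<close> 70) where
  "f \<lhd>\<^bsub>K\<^esub> \<alpha> = Id2 K f \<star>\<^bsub>K\<^esub> \<alpha>"

definition whisker_right :: "('o, 'm, 'c) two_cat \<Rightarrow> 'c \<Rightarrow> 'm \<Rightarrow> 'c"  (infixl \<open>\<rhd>\<index>\<close> 71) where
  "\<alpha> \<rhd>\<^bsub>K\<^esub> f = \<alpha> \<star>\<^bsub>K\<^esub> Id2 K f"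

locale two_category =
  fixes K :: "('o, 'm, 'c) two_cat" (structure)
  assumes Src_Obj: "f \<in> Arr K \<Longrightarrow> Src K f \<in> Obj K"
    and Tgt_Obj: "f \<in> Arr K \<Longrightarrow> Tgt K f \<in> Obj K"
    and Dom_Arr: "\<alpha> \<in> Cell K \<Longrightarrow> Dom K \<alpha> \<in> Arr K"
    and Cod_Arr: "\<alpha> \<in> Cell K \<Longrightarrow> Cod K \<alpha> \<in> Arr K"
    and Src_Cod: "\<alpha> \<in> Cell K \<Longrightarrow> Src K (Cod K \<alpha>) = Src K (Dom K \<alpha>)"
    and Tgt_Cod: "\<alpha> \<in> Cell K \<Longrightarrow> Tgt K (Cod K \<alpha>) = Tgt K (Dom K \<alpha>)"
    and Id1_hom: "A \<in> Obj K \<Longrightarrow> Id1 K A \<in> hom1 K A A"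
    and Comp1_hom: "\<lbrakk>f \<in> hom1 K A B; g \<in> hom1 K B C\<rbrakk> \<Longrightarrow> g \<odot> f \<in> hom1 K A C"
    and Comp1_assoc: "\<lbrakk>f \<in> hom1 K A B; g \<in> hom1 K B C; h \<in> hom1 K C D\<rbrakk> \<Longrightarrow>
      (h \<odot> g) \<odot> f = h \<odot> g \<odot> f"
    and Id1_left: "f \<in> hom1 K A B \<Longrightarrow> Id1 K B \<odot> f = f"
    and Id1_right: "f \<in> hom1 K A B \<Longrightarrow> f \<odot> Id1 K A = f"
    and Id2_hom: "f \<in> Arr K \<Longrightarrow> Id2 K f \<in> hom2 K f f"
    and VComp_hom: "\<lbrakk>\<alpha> \<in> hom2 K f g; \<beta> \<in> hom2 K g h\<rbrakk> \<Longrightarrow> \<beta> \<bullet> \<alpha> \<in> hom2 K f h"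
    and VComp_assoc: "\<lbrakk>\<alpha> \<in> hom2 K f g; \<beta> \<in> hom2 K g h; \<gamma> \<in> hom2 K h k\<rbrakk> \<Longrightarrow>
      (\<gamma> \<bullet> \<beta>) \<bullet> \<alpha> = \<gamma> \<bullet> \<beta> \<bullet> \<alpha>"
    and Id2_left: "\<alpha> \<in> hom2 K f g \<Longrightarrow> Id2 K g \<bullet> \<alpha> = \<alpha>"
    and Id2_right: "\<alpha> \<in> hom2 K f g \<Longrightarrow> \<alpha> \<bullet> Id2 K f = \<alpha>"
    and HComp_hom: "\<lbrakk>f \<in> hom1 K A B; g \<in> hom1 K B C; \<alpha> \<in> hom2 K f f'; \<beta> \<in> hom2 K g g'\<rbrakk> \<Longrightarrow>
      \<beta> \<star> \<alpha> \<in> hom2 K (g \<odot> f) (g' \<odot> f')"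
    and HComp_assoc: "\<lbrakk>f \<in> hom1 K A B; g \<in> hom1 K B C; h \<in> hom1 K C D;
      \<alpha> \<in> hom2 K f f'; \<beta> \<in> hom2 K g g'; \<gamma> \<in> hom2 K h h'\<rbrakk> \<Longrightarrow>
      (\<gamma> \<star> \<beta>) \<star> \<alpha> = \<gamma> \<star> \<beta> \<star> \<alpha>"
    and HComp_Id1_left: "\<lbrakk>f \<in> hom1 K A B; \<alpha> \<in> hom2 K f g\<rbrakk> \<Longrightarrow> Id2 K (Id1 K B) \<star> \<alpha> = \<alpha>"
    and HComp_Id1_right: "\<lbrakk>f \<in> hom1 K A B; \<alpha> \<in> hom2 K f g\<rbrakk> \<Longrightarrow> \<alpha> \<star> Id2 K (Id1 K A) = \<alpha>"
    and HComp_Id2: "\<lbrakk>f \<in> hom1 K A B; g \<in> hom1 K B C\<rbrakk> \<Longrightarrow> Id2 K g \<star> Id2 K f = Id2 K (g \<odot> f)"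
    and interchange: "\<lbrakk>f \<in> hom1 K A B; g \<in> hom1 K B C; \<alpha> \<in> hom2 K f f'; \<alpha>' \<in> hom2 K f' f'';
      \<beta> \<in> hom2 K g g'; \<beta>' \<in> hom2 K g' g''\<rbrakk> \<Longrightarrow>
      (\<beta>' \<bullet> \<beta>) \<star> (\<alpha>' \<bullet> \<alpha>) = (\<beta>' \<star> \<alpha>') \<bullet> (\<beta> \<star> \<alpha>)"

locale two_functor = C: two_category C + D: two_category D
  for C :: "('o, 'm, 'c) two_cat" and D :: "('p, 'n, 'd) two_cat" +
  fixes F0 :: "'o \<Rightarrow> 'p" and F1 :: "'m \<Rightarrow> 'n" and F2 :: "'c \<Rightarrow> 'd"
  assumes F0_Obj: "A \<in> Obj C \<Longrightarrow> F0 A \<in> Obj D"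
    and F1_hom: "f \<in> hom1 C A B \<Longrightarrow> F1 f \<in> hom1 D (F0 A) (F0 B)"
    and F2_hom: "\<alpha> \<in> hom2 C f g \<Longrightarrow> F2 \<alpha> \<in> hom2 D (F1 f) (F1 g)"
    and F1_Id: "A \<in> Obj C \<Longrightarrow> F1 (Id1 C A) = Id1 D (F0 A)"
    and F1_Comp: "\<lbrakk>f \<in> hom1 C A B; g \<in> hom1 C B X\<rbrakk> \<Longrightarrow> F1 (g \<odot>\<^bsub>C\<^esub> f) = F1 g \<odot>\<^bsub>D\<^esub> F1 f"
    and F2_Id: "f \<in> Arr C \<Longrightarrow> F2 (Id2 C f) = Id2 D (F1 f)"
    and F2_VComp: "\<lbrakk>\<alpha> \<in> hom2 C f g; \<beta> \<in> hom2 C g h\<rbrakk> \<Longrightarrow> F2 (\<beta> \<bullet>\<^bsub>C\<^esub> \<alpha>) = F2 \<beta> \<bullet>\<^bsub>D\<^esub> F2 \<alpha>"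
    and F2_HComp: "\<lbrakk>f \<in> hom1 C A B; g \<in> hom1 C B X; \<alpha> \<in> hom2 C f f'; \<beta> \<in> hom2 C g g'\<rbrakk> \<Longrightarrow>
      F2 (\<beta> \<star>\<^bsub>C\<^esub> \<alpha>) = F2 \<beta> \<star>\<^bsub>D\<^esub> F2 \<alpha>"


section \<open>Pseudofunctors, pseudonatural transformations, modifications\<close>

record ('o, 'm, 'c, 'p, 'n, 'd) psfunctor =
  Map0 :: "'o \<Rightarrow> 'p"
  Map1 :: "'m \<Rightarrow> 'n"
  Map2 :: "'c \<Rightarrow> 'd"
  Kap :: "'m \<Rightarrow> 'm \<Rightarrow> 'd"
  Ups :: "'o \<Rightarrow> 'd"

locale pseudofunctor = C: two_category C + D: two_category D
  for C :: "('o, 'm, 'c) two_cat" and D :: "('p, 'n, 'd) two_cat" (structure) +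
  fixes F :: "('o, 'm, 'c, 'p, 'n, 'd) psfunctor"
  assumes Map0_Obj: "A \<in> Obj C \<Longrightarrow> Map0 F A \<in> Obj D"
    and Map1_hom: "f \<in> hom1 C A B \<Longrightarrow> Map1 F f \<in> hom1 D (Map0 F A) (Map0 F B)"
    and Map2_hom: "\<alpha> \<in> hom2 C f g \<Longrightarrow> Map2 F \<alpha> \<in> hom2 D (Map1 F f) (Map1 F g)"
    and Map2_Id: "f \<in> Arr C \<Longrightarrow> Map2 F (Id2 C f) = Id2 D (Map1 F f)"
    and Map2_VComp: "\<lbrakk>\<alpha> \<in> hom2 C f g; \<beta> \<in> hom2 C g h\<rbrakk> \<Longrightarrow>
      Map2 F (\<beta> \<bullet>\<^bsub>C\<^esub> \<alpha>) = Map2 F \<beta> \<bullet> Map2 F \<alpha>"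
    and Kap_iso: "\<lbrakk>f \<in> hom1 C A B; g \<in> hom1 C B X\<rbrakk> \<Longrightarrow>
      Kap F g f \<in> iso2 D (Map1 F g \<odot> Map1 F f) (Map1 F (g \<odot>\<^bsub>C\<^esub> f))"
    and Ups_iso: "A \<in> Obj C \<Longrightarrow> Ups F A \<in> iso2 D (Id1 D (Map0 F A)) (Map1 F (Id1 C A))"
    and Kap_nat: "\<lbrakk>f \<in> hom1 C A B; g \<in> hom1 C B X; \<alpha> \<in> hom2 C f f'; \<beta> \<in> hom2 C g g'\<rbrakk> \<Longrightarrow>
      Kap F g' f' \<bullet> (Map2 F \<beta> \<star> Map2 F \<alpha>) = Map2 F (\<beta> \<star>\<^bsub>C\<^esub> \<alpha>) \<bullet> Kap F g f"
    and Kap_assoc: "\<lbrakk>f \<in> hom1 C A B; g \<in> hom1 C B X; h \<in> hom1 C X Y\<rbrakk> \<Longrightarrow>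
      Kap F (h \<odot>\<^bsub>C\<^esub> g) f \<bullet> (Kap F h g \<rhd> Map1 F f) =
      Kap F h (g \<odot>\<^bsub>C\<^esub> f) \<bullet> (Map1 F h \<lhd> Kap F g f)"
    and Kap_Ups_right: "f \<in> hom1 C A B \<Longrightarrow>
      Kap F f (Id1 C A) \<bullet> (Map1 F f \<lhd> Ups F A) = Id2 D (Map1 F f)"
    and Kap_Ups_left: "f \<in> hom1 C A B \<Longrightarrow>
      Kap F (Id1 C B) f \<bullet> (Ups F B \<rhd> Map1 F f) = Id2 D (Map1 F f)"

definition id_psf :: "('o, 'm, 'c) two_cat \<Rightarrow> ('o, 'm, 'c, 'o, 'm, 'c) psfunctor" where
  "id_psf C = \<lparr>Map0 = (\<lambda>A. A), Map1 = (\<lambda>f. f), Map2 = (\<lambda>\<alpha>. \<alpha>),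
     Kap = (\<lambda>g f. Id2 C (g \<odot>\<^bsub>C\<^esub> f)), Ups = (\<lambda>A. Id2 C (Id1 C A))\<rparr>"

text \<open>\<open>comp_psf E G F\<close> is \<open>G\<close> after \<open>F\<close>, where \<open>E\<close> is the codomain of \<open>G\<close>.\<close>

definition comp_psf :: "('q, 'k, 'e) two_cat \<Rightarrow> ('p, 'n, 'd, 'q, 'k, 'e) psfunctor \<Rightarrow>
    ('o, 'm, 'c, 'p, 'n, 'd) psfunctor \<Rightarrow> ('o, 'm, 'c, 'q, 'k, 'e) psfunctor" where
  "comp_psf E G F = \<lparr>Map0 = (\<lambda>A. Map0 G (Map0 F A)), Map1 = (\<lambda>f. Map1 G (Map1 F f)),
     Map2 = (\<lambda>\<alpha>. Map2 G (Map2 F \<alpha>)),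
     Kap = (\<lambda>g f. Map2 G (Kap F g f) \<bullet>\<^bsub>E\<^esub> Kap G (Map1 F g) (Map1 F f)),
     Ups = (\<lambda>A. Map2 G (Ups F A) \<bullet>\<^bsub>E\<^esub> Ups G (Map0 F A))\<rparr>"

record ('o, 'm, 'n, 'd) pstrans =
  Cmp :: "'o \<Rightarrow> 'n"
  Str :: "'m \<Rightarrow> 'd"

locale pseudonatural = S: pseudofunctor C D S + T: pseudofunctor C D T
  for C :: "('o, 'm, 'c) two_cat" and D :: "('p, 'n, 'd) two_cat" (structure)
    and S T :: "('o, 'm, 'c, 'p, 'n, 'd) psfunctor" +
  fixes \<alpha> :: "('o, 'm, 'n, 'd) pstrans"
  assumes Cmp_hom: "X \<in> Obj C \<Longrightarrow> Cmp \<alpha> X \<in> hom1 D (Map0 S X) (Map0 T X)"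
    and Nat_iso: "f \<in> hom1 C X Y \<Longrightarrow>
      Str \<alpha> f \<in> iso2 D (Cmp \<alpha> Y \<odot> Map1 S f) (Map1 T f \<odot> Cmp \<alpha> X)"
    and Nat_nat: "\<lbrakk>f \<in> hom1 C X Y; \<theta> \<in> hom2 C f g\<rbrakk> \<Longrightarrow>
      (Map2 T \<theta> \<rhd> Cmp \<alpha> X) \<bullet> Str \<alpha> f = Str \<alpha> g \<bullet> (Cmp \<alpha> Y \<lhd> Map2 S \<theta>)"
    and Nat_Comp: "\<lbrakk>f \<in> hom1 C X Y; g \<in> hom1 C Y Z\<rbrakk> \<Longrightarrow>
      Str \<alpha> (g \<odot>\<^bsub>C\<^esub> f) \<bullet> (Cmp \<alpha> Z \<lhd> Kap S g f) =
      (Kap T g f \<rhd> Cmp \<alpha> X) \<bullet> (Map1 T g \<lhd> Str \<alpha> f) \<bullet> (Str \<alpha> g \<rhd> Map1 S f)"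
    and Nat_Id: "X \<in> Obj C \<Longrightarrow>
      Str \<alpha> (Id1 C X) \<bullet> (Cmp \<alpha> X \<lhd> Ups S X) = Ups T X \<rhd> Cmp \<alpha> X"

definition id_pst :: "('p, 'n, 'd) two_cat \<Rightarrow> ('o, 'm, 'c, 'p, 'n, 'd) psfunctor \<Rightarrow>
    ('o, 'm, 'n, 'd) pstrans" where
  "id_pst D T = \<lparr>Cmp = (\<lambda>X. Id1 D (Map0 T X)), Str = (\<lambda>f. Id2 D (Map1 T f))\<rparr>"

definition comp_pst :: "('o, 'm, 'c) two_cat \<Rightarrow> ('p, 'n, 'd) two_cat \<Rightarrow> ('o, 'm, 'n, 'd) pstrans \<Rightarrow>
    ('o, 'm, 'n, 'd) pstrans \<Rightarrow> ('o, 'm, 'n, 'd) pstrans" where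
  "comp_pst C D \<beta> \<alpha> = \<lparr>Cmp = (\<lambda>X. Cmp \<beta> X \<odot>\<^bsub>D\<^esub> Cmp \<alpha> X),
     Str = (\<lambda>f. (Str \<beta> f \<rhd>\<^bsub>D\<^esub> Cmp \<alpha> (Src C f)) \<bullet>\<^bsub>D\<^esub> (Cmp \<beta> (Tgt C f) \<lhd>\<^bsub>D\<^esub> Str \<alpha> f))\<rparr>"

text \<open>The whiskerings \<open>\<alpha>F\<close> and \<open>G\<alpha>\<close> of \<open>\<alpha> : S \<Rightarrow> T\<close>.\<close>

definition pre_pst :: "('p, 'n, 'k, 'e) pstrans \<Rightarrow> ('o, 'm, 'c, 'p, 'n, 'd) psfunctor \<Rightarrow>
    ('o, 'm, 'k, 'e) pstrans" where
  "pre_pst \<alpha> F = \<lparr>Cmp = (\<lambda>X. Cmp \<alpha> (Map0 F X)), Str = (\<lambda>f. Str \<alpha> (Map1 F f))\<rparr>"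

definition post_pst :: "('o, 'm, 'c) two_cat \<Rightarrow> ('q, 'k, 'e) two_cat \<Rightarrow>
    ('p, 'n, 'd, 'q, 'k, 'e) psfunctor \<Rightarrow> ('o, 'm, 'c, 'p, 'n, 'd) psfunctor \<Rightarrow>
    ('o, 'm, 'c, 'p, 'n, 'd) psfunctor \<Rightarrow> ('o, 'm, 'n, 'd) pstrans \<Rightarrow> ('o, 'm, 'k, 'e) pstrans" where
  "post_pst C E G S T \<alpha> = \<lparr>Cmp = (\<lambda>X. Map1 G (Cmp \<alpha> X)),
     Str = (\<lambda>f. inv2\<^bsub>E\<^esub> (Kap G (Map1 T f) (Cmp \<alpha> (Src C f))) \<bullet>\<^bsub>E\<^esub>
               Map2 G (Str \<alpha> f) \<bullet>\<^bsub>E\<^esub> Kap G (Cmp \<alpha> (Tgt C f)) (Map1 S f))\<rparr>"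

locale modification = \<alpha>: pseudonatural C D S T \<alpha> + \<beta>: pseudonatural C D S T \<beta>
  for C :: "('o, 'm, 'c) two_cat" and D :: "('p, 'n, 'd) two_cat" (structure)
    and S T :: "('o, 'm, 'c, 'p, 'n, 'd) psfunctor" and \<alpha> \<beta> :: "('o, 'm, 'n, 'd) pstrans" +
  fixes \<Gamma> :: "'o \<Rightarrow> 'd"
  assumes mod_hom: "X \<in> Obj C \<Longrightarrow> \<Gamma> X \<in> hom2 D (Cmp \<alpha> X) (Cmp \<beta> X)"
    and mod_nat: "f \<in> hom1 C X Y \<Longrightarrow>
      (Map1 T f \<lhd> \<Gamma> X) \<bullet> Str \<alpha> f = Str \<beta> f \<bullet> (\<Gamma> Y \<rhd> Map1 S f)"

locale invertible_modification = modification +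
  assumes mod_iso: "X \<in> Obj C \<Longrightarrow> \<Gamma> X \<in> iso2 D (Cmp \<alpha> X) (Cmp \<beta> X)"


section \<open>Pseudomonads\<close>

record ('o, 'm, 'c) psmonad =
  Fun :: "('o, 'm, 'c, 'o, 'm, 'c) psfunctor"
  Mu :: "('o, 'm, 'm, 'c) pstrans"
  Eta :: "('o, 'm, 'm, 'c) pstrans"
  Lun :: "'o \<Rightarrow> 'c"
  Run :: "'o \<Rightarrow> 'c"
  Asc :: "'o \<Rightarrow> 'c"

locale pseudomonad_data =
  fixes K :: "('o, 'm, 'c) two_cat" (structure) and M :: "('o, 'm, 'c) psmonad"
begin

abbreviation "T \<equiv> Fun M"
abbreviation "TT \<equiv> comp_psf K T T"
abbreviation "TTT \<equiv> comp_psf K T TT"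
abbreviation "T\<^sub>0 \<equiv> Map0 T"
abbreviation "T\<^sub>1 \<equiv> Map1 T"
abbreviation "T\<^sub>2 \<equiv> Map2 T"
abbreviation "\<kappa> \<equiv> Kap T"
abbreviation "\<upsilon> \<equiv> Ups T"
abbreviation "\<mu> \<equiv> Cmp (Mu M)"
abbreviation "\<mu>\<^sub>1 \<equiv> Str (Mu M)"
abbreviation "\<eta> \<equiv> Cmp (Eta M)"
abbreviation "\<eta>\<^sub>1 \<equiv> Str (Eta M)"
abbreviation "lun \<equiv> Lun M"
abbreviation "run \<equiv> Run M"
abbreviation "asc \<equiv> Asc M"

end

text \<open>The two coherence laws are equations of modifications, stated at each component.\<close>

locale pseudomonad = pseudomonad_data K M + two_category K
  for K :: "('o, 'm, 'c) two_cat" (structure) and M :: "('o, 'm, 'c) psmonad" +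
  assumes T_pseudofunctor: "pseudofunctor K K T"
    and eta_pseudonatural: "pseudonatural K K (id_psf K) T (Eta M)"
    and mu_pseudonatural: "pseudonatural K K TT T (Mu M)"
    and lun_modification: "invertible_modification K K T T
      (comp_pst K K (Mu M) (pre_pst (Eta M) T)) (id_pst K T) lun"
    and run_modification: "invertible_modification K K T T
      (id_pst K T) (comp_pst K K (Mu M) (post_pst K K T (id_psf K) T (Eta M))) run"
    and asc_modification: "invertible_modification K K TTT T
      (comp_pst K K (Mu M) (post_pst K K T TT T (Mu M))) (comp_pst K K (Mu M) (pre_pst (Mu M) T)) asc"
    and unit_law: "X \<in> Obj K \<Longrightarrow>
      asc X \<rhd> T\<^sub>1 (\<eta> (T\<^sub>0 X)) =
      (\<mu> X \<lhd> run (T\<^sub>0 X)) \<bullet>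
      (\<mu> X \<lhd> (inv2 (\<upsilon> (T\<^sub>0 X)) \<bullet> T\<^sub>2 (lun X) \<bullet> \<kappa> (\<mu> X) (\<eta> (T\<^sub>0 X))))"
    and pentagon_law: "X \<in> Obj K \<Longrightarrow>
      (\<mu> X \<lhd> asc (T\<^sub>0 X)) \<bullet>
      (asc X \<rhd> T\<^sub>1 (\<mu> (T\<^sub>0 X))) \<bullet>
      (\<mu> X \<lhd> (inv2 (\<kappa> (\<mu> X) (\<mu> (T\<^sub>0 X))) \<bullet> T\<^sub>2 (asc X) \<bullet> \<kappa> (\<mu> X) (T\<^sub>1 (\<mu> X)))) =
      (asc X \<rhd> \<mu> (T\<^sub>0 (T\<^sub>0 X))) \<bullet>
      (\<mu> X \<lhd> \<mu>\<^sub>1 (\<mu> X)) \<bullet>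
      (asc X \<rhd> T\<^sub>1 (T\<^sub>1 (\<mu> X)))"


section \<open>Pseudomorphisms of pseudomonads\<close>

record ('o, 'm, 'c) psmonad_mor =
  Lam :: "('o, 'm, 'm, 'c) pstrans"
  Umod :: "'o \<Rightarrow> 'c"
  Mmod :: "'o \<Rightarrow> 'c"

locale pseudomonad_morphism_data = M: pseudomonad_data K M + M': pseudomonad_data K M'
  for K :: "('o, 'm, 'c) two_cat" (structure) and M M' :: "('o, 'm, 'c) psmonad" +
  fixes L :: "('o, 'm, 'c) psmonad_mor"
begin

abbreviation "lam \<equiv> Cmp (Lam L)"
abbreviation "lam\<^sub>1 \<equiv> Str (Lam L)"
abbreviation "u \<equiv> Umod L"
abbreviation "m \<equiv> Mmod L"

abbreviation "lamlam \<equiv>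
  comp_pst K K (pre_pst (Lam L) M'.T) (post_pst K K M.T M.T M'.T (Lam L))"

end

locale pseudomonad_morphism = pseudomonad_morphism_data K M M' L + M: pseudomonad K M + M': pseudomonad K M'
  for K :: "('o, 'm, 'c) two_cat" (structure) and M M' :: "('o, 'm, 'c) psmonad"
    and L :: "('o, 'm, 'c) psmonad_mor" +
  assumes lam_pseudonatural: "pseudonatural K K M.T M'.T (Lam L)"
    and u_modification: "invertible_modification K K (id_psf K) M'.T
      (Eta M') (comp_pst K K (Lam L) (Eta M)) u"
    and m_modification: "invertible_modification K K M.TT M'.T
      (comp_pst K K (Mu M') lamlam) (comp_pst K K (Lam L) (Mu M)) m"
    and left_unit_law: "X \<in> Obj K \<Longrightarrow>
      M'.lun X \<rhd> lam X =
      (lam X \<lhd> M.lun X) \<bullet>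
      (m X \<rhd> M.\<eta> (M.T\<^sub>0 X)) \<bullet>
      (M'.\<mu> X \<lhd> ((lam (M'.T\<^sub>0 X) \<lhd> M.\<eta>\<^sub>1 (lam X)) \<bullet> (u (M'.T\<^sub>0 X) \<rhd> lam X)))"
    and right_unit_law: "X \<in> Obj K \<Longrightarrow>
      lam X \<lhd> M.run X =
      (m X \<rhd> M.T\<^sub>1 (M.\<eta> X)) \<bullet>
      (M'.\<mu> X \<lhd> ((lam (M'.T\<^sub>0 X) \<lhd> (inv2 (M.\<kappa> (lam X) (M.\<eta> X)) \<bullet> M.T\<^sub>2 (u X))) \<bullet>
                 inv2 (lam\<^sub>1 (M'.\<eta> X)))) \<bullet>
      (M'.run X \<rhd> lam X)"
    and associativity_law: "X \<in> Obj K \<Longrightarrow>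
      (lam X \<lhd> M.asc X) \<bullet>
      (m X \<rhd> M.T\<^sub>1 (M.\<mu> X)) \<bullet>
      (M'.\<mu> X \<lhd>
        ((lam (M'.T\<^sub>0 X) \<lhd>
           (inv2 (M.\<kappa> (lam X) (M.\<mu> X)) \<bullet> M.T\<^sub>2 (m X) \<bullet>
            M.\<kappa> (M'.\<mu> X) (lam (M'.T\<^sub>0 X) \<odot> M.T\<^sub>1 (lam X)) \<bullet>
            (M.T\<^sub>1 (M'.\<mu> X) \<lhd> M.\<kappa> (lam (M'.T\<^sub>0 X)) (M.T\<^sub>1 (lam X))))) \<bullet>
         (inv2 (lam\<^sub>1 (M'.\<mu> X)) \<rhd> (M.T\<^sub>1 (lam (M'.T\<^sub>0 X)) \<odot> M.T\<^sub>1 (M.T\<^sub>1 (lam X)))))) =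
      (m X \<rhd> M.\<mu> (M.T\<^sub>0 X)) \<bullet>
      (M'.\<mu> X \<lhd>
        ((lam (M'.T\<^sub>0 X) \<lhd> M.\<mu>\<^sub>1 (lam X)) \<bullet> (m (M'.T\<^sub>0 X) \<rhd> M.T\<^sub>1 (M.T\<^sub>1 (lam X))))) \<bullet>
      (M'.asc X \<rhd>
        (lam (M'.T\<^sub>0 (M'.T\<^sub>0 X)) \<odot> M.T\<^sub>1 (lam (M'.T\<^sub>0 X)) \<odot> M.T\<^sub>1 (M.T\<^sub>1 (lam X))))"


section \<open>The 2-category of pseudoalgebras\<close>

record ('o, 'm, 'c) psalg =
  Car :: 'o
  Act :: 'm
  Iota :: 'c
  Gam :: 'c

locale pseudoalgebra = pseudomonad K M
  for K :: "('o, 'm, 'c) two_cat" (structure) and M :: "('o, 'm, 'c) psmonad" +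
  fixes A :: "('o, 'm, 'c) psalg"
  assumes Car_Obj: "Car A \<in> Obj K"
    and Act_hom: "Act A \<in> hom1 K (T\<^sub>0 (Car A)) (Car A)"
    and Iota_iso: "Iota A \<in> iso2 K (Act A \<odot> \<eta> (Car A)) (Id1 K (Car A))"
    and Gam_iso: "Gam A \<in> iso2 K (Act A \<odot> T\<^sub>1 (Act A)) (Act A \<odot> \<mu> (Car A))"
    and alg_unit_law:
      "Gam A \<rhd> T\<^sub>1 (\<eta> (Car A)) =
       (Act A \<lhd> run (Car A)) \<bullet>
       (Act A \<lhd> (inv2 (\<upsilon> (Car A)) \<bullet> T\<^sub>2 (Iota A) \<bullet> \<kappa> (Act A) (\<eta> (Car A))))"
    and alg_assoc_law:
      "(Act A \<lhd> asc (Car A)) \<bullet>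
       (Gam A \<rhd> T\<^sub>1 (\<mu> (Car A))) \<bullet>
       (Act A \<lhd> (inv2 (\<kappa> (Act A) (\<mu> (Car A))) \<bullet> T\<^sub>2 (Gam A) \<bullet> \<kappa> (Act A) (T\<^sub>1 (Act A)))) =
       (Gam A \<rhd> \<mu> (T\<^sub>0 (Car A))) \<bullet>
       (Act A \<lhd> \<mu>\<^sub>1 (Act A)) \<bullet>
       (Gam A \<rhd> T\<^sub>1 (T\<^sub>1 (Act A)))"

text \<open>A morphism \<open>(f, \<phi>)\<close> and a 2-cell \<open>\<alpha>\<close> are stored together with their source and target.\<close>

record ('o, 'm, 'c) psalg_mor =
  MSrc :: "('o, 'm, 'c) psalg"
  MTgt :: "('o, 'm, 'c) psalg"
  MArr :: 'm
  MCell :: 'c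

record ('o, 'm, 'c) psalg_cell =
  CDom :: "('o, 'm, 'c) psalg_mor"
  CCod :: "('o, 'm, 'c) psalg_mor"
  CCell :: 'c

locale pseudoalgebra_morphism =
  A: pseudoalgebra K M A + B: pseudoalgebra K M B
  for K :: "('o, 'm, 'c) two_cat" (structure) and M :: "('o, 'm, 'c) psmonad"
    and A B :: "('o, 'm, 'c) psalg" +
  fixes f :: 'm and \<phi> :: 'c
  assumes f_hom: "f \<in> hom1 K (Car A) (Car B)"
    and phi_iso: "\<phi> \<in> iso2 K (Act B \<odot> A.T\<^sub>1 f) (f \<odot> Act A)"
    and mor_unit_law:
      "Iota B \<rhd> f = (f \<lhd> Iota A) \<bullet> (\<phi> \<rhd> A.\<eta> (Car A)) \<bullet> (Act B \<lhd> A.\<eta>\<^sub>1 f)"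
    and mor_assoc_law:
      "(f \<lhd> Gam A) \<bullet>
       (\<phi> \<rhd> A.T\<^sub>1 (Act A)) \<bullet>
       (Act B \<lhd> (inv2 (A.\<kappa> f (Act A)) \<bullet> A.T\<^sub>2 \<phi> \<bullet> A.\<kappa> (Act B) (A.T\<^sub>1 f))) =
       (\<phi> \<rhd> A.\<mu> (Car A)) \<bullet> (Act B \<lhd> A.\<mu>\<^sub>1 f) \<bullet> (Gam B \<rhd> A.T\<^sub>1 (A.T\<^sub>1 f))"

context pseudomonad_data
begin

definition is_mor :: "('o, 'm, 'c) psalg_mor \<Rightarrow> bool" where
  "is_mor F \<longleftrightarrow> pseudoalgebra_morphism K M (MSrc F) (MTgt F) (MArr F) (MCell F)"

definition is_cell :: "('o, 'm, 'c) psalg_cell \<Rightarrow> bool" where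
  "is_cell \<alpha> \<longleftrightarrow> is_mor (CDom \<alpha>) \<and> is_mor (CCod \<alpha>) \<and>
     MSrc (CCod \<alpha>) = MSrc (CDom \<alpha>) \<and> MTgt (CCod \<alpha>) = MTgt (CDom \<alpha>) \<and>
     CCell \<alpha> \<in> hom2 K (MArr (CDom \<alpha>)) (MArr (CCod \<alpha>)) \<and>
     (CCell \<alpha> \<rhd> Act (MSrc (CDom \<alpha>))) \<bullet> MCell (CDom \<alpha>) =
     MCell (CCod \<alpha>) \<bullet> (Act (MTgt (CDom \<alpha>)) \<lhd> T\<^sub>2 (CCell \<alpha>))"

definition id_mor :: "('o, 'm, 'c) psalg \<Rightarrow> ('o, 'm, 'c) psalg_mor" where
  "id_mor A = \<lparr>MSrc = A, MTgt = A, MArr = Id1 K (Car A), MCell = Act A \<lhd> inv2 (\<upsilon> (Car A))\<rparr>"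

definition comp_mor :: "('o, 'm, 'c) psalg_mor \<Rightarrow> ('o, 'm, 'c) psalg_mor \<Rightarrow> ('o, 'm, 'c) psalg_mor" where
  "comp_mor G F = \<lparr>MSrc = MSrc F, MTgt = MTgt G, MArr = MArr G \<odot> MArr F,
     MCell = (MArr G \<lhd> MCell F) \<bullet> (MCell G \<rhd> T\<^sub>1 (MArr F)) \<bullet>
             (Act (MTgt G) \<lhd> inv2 (\<kappa> (MArr G) (MArr F)))\<rparr>"

definition pseudoalgebras ::
  "(('o, 'm, 'c) psalg, ('o, 'm, 'c) psalg_mor, ('o, 'm, 'c) psalg_cell) two_cat" where
  "pseudoalgebras =
     \<lparr>Obj = {A. pseudoalgebra K M A}, Arr = {F. is_mor F}, Cell = {\<alpha>. is_cell \<alpha>},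
      Src = MSrc, Tgt = MTgt, Dom = CDom, Cod = CCod,
      Id1 = id_mor, Comp1 = comp_mor,
      Id2 = (\<lambda>F. \<lparr>CDom = F, CCod = F, CCell = Id2 K (MArr F)\<rparr>),
      VComp = (\<lambda>\<beta> \<alpha>. \<lparr>CDom = CDom \<alpha>, CCod = CCod \<beta>, CCell = CCell \<beta> \<bullet> CCell \<alpha>\<rparr>),
      HComp = (\<lambda>\<beta> \<alpha>. \<lparr>CDom = comp_mor (CDom \<beta>) (CDom \<alpha>), CCod = comp_mor (CCod \<beta>) (CCod \<alpha>),
                     CCell = CCell \<beta> \<star> CCell \<alpha>\<rparr>)\<rparr>"

end


section \<open>Restriction of pseudoalgebras along a pseudomorphism\<close>

context pseudomonad_morphism_data
begin

text \<open>The source of \<open>\<gamma>\<close> is \<open>e \<odot> T\<^sub>1 e\<close> with \<open>e = e' \<odot> lam A\<close>, so the composite starts with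
  the inverse compositor that splits \<open>T\<^sub>1 (e' \<odot> lam A)\<close>.\<close>

definition restrict_alg :: "('o, 'm, 'c) psalg \<Rightarrow> ('o, 'm, 'c) psalg" where
  "restrict_alg A' = (let A = Car A'; e' = Act A' in
    \<lparr>Car = A,
     Act = e' \<odot> lam A,
     Iota = Iota A' \<bullet> (e' \<lhd> inv2 (u A)),
     Gam = (e' \<lhd> m A) \<bullet>
           (Gam A' \<rhd> (lam (M'.T\<^sub>0 A) \<odot> M.T\<^sub>1 (lam A))) \<bullet>
           (e' \<lhd> (lam\<^sub>1 e' \<rhd> M.T\<^sub>1 (lam A))) \<bullet>
           ((e' \<odot> lam A) \<lhd> inv2 (M.\<kappa> e' (lam A)))\<rparr>)"

text \<open>\<open>(f, \<phi>)\<close> is sent to \<open>f\<close> with \<open>e\<^sub>B \<odot> lam B \<odot> T\<^sub>1 f \<Rightarrow> e\<^sub>B \<odot> T'\<^sub>1 f \<odot> lam A \<Rightarrow> f \<odot> e\<^sub>A \<odot> lam A\<close>.\<close>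

definition restrict_mor :: "('o, 'm, 'c) psalg_mor \<Rightarrow> ('o, 'm, 'c) psalg_mor" where
  "restrict_mor F =
    \<lparr>MSrc = restrict_alg (MSrc F), MTgt = restrict_alg (MTgt F), MArr = MArr F,
     MCell = (MCell F \<rhd> lam (Car (MSrc F))) \<bullet> (Act (MTgt F) \<lhd> lam\<^sub>1 (MArr F))\<rparr>"

definition restrict_cell :: "('o, 'm, 'c) psalg_cell \<Rightarrow> ('o, 'm, 'c) psalg_cell" where
  "restrict_cell \<alpha> =
    \<lparr>CDom = restrict_mor (CDom \<alpha>), CCod = restrict_mor (CCod \<alpha>), CCell = CCell \<alpha>\<rparr>"

end

end

theory Submission
  imports Defs
begin

text \<open>The associativity law of a pseudoalgebra \<open>(A, e', \<iota>', \<gamma>')\<close> says that \<open>(e', \<gamma>')\<close> satisfies the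
  associativity law of a morphism out of the free algebra \<open>(T'A, \<mu>', a')\<close>. Therefore one
  pasting, which slides \<open>\<mu>\<close> along \<open>m\<close> and \<open>\<lambda>\<close> through a 2-cell \<open>\<phi> : e\<^sub>B \<odot> T'f \<Rightarrow> f \<odot> e\<^sub>A\<close> subject to
  that law, serves both the restricted algebra and the restricted morphisms: it combines
  the modification axiom of \<open>m\<close> at \<open>f\<close>, the law for \<open>\<phi>\<close>, and the naturality of \<open>\<lambda>\<close> at \<open>\<phi>\<close>. For
  the algebra the associativity law of \<open>(\<lambda>, u, m)\<close> then moves \<open>a'\<close> to \<open>a\<close>. All equations are compared
  after precomposing with the compositors that split \<open>T (e' \<odot> \<lambda>)\<close> and its iterates.\<close>

text \<open>The simp rules hold a normal form for pastings: composites of 1-cells and vertical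
  composites associate to the right, whiskerings are distributed over vertical composites, left
  whiskerings stand outside right ones, and adjacent inverses cancel. Interchange has no preferred
  direction and is kept out. The long calculations therefore alternate: regroup until two
  neighbouring whiskered cells are in view, swap them with \<open>whisker_exchange\<close> or
  replace a block by a law, and let \<open>simp\<close> restore the normal form. Compositors are the
  main obstacle. \<open>M.T\<^sub>1\<close> of a composite is not the composite of the images, so
  the cells to be exchanged have matching boundaries only after compositors are inserted. For this
  reason images of 2-cells are used in conjugated form (the \<open>X\<close>, \<open>Y\<close>,
  \<open>G\<close>, \<open>H\<close>, \<open>Q\<close> below), and the coherence axioms are first
  solved for the cell at a composite, which makes them rewrite rules.\<close>

section \<open>Pasting in a 2-category\<close>

text \<open>Typing facts are written \<open>ty2 \<alpha> = bd f g\<close>. When such a fact is the premise of a simplification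
  rule, the boundary is found by evaluating \<open>ty2 \<alpha>\<close> and solving the premise by reflexivity; with
  premises about \<open>Dom\<close> and \<open>Cod\<close> instead, the cost of checking that a pasting diagram is
  well formed would be exponential in its size. For this, \<open>bd\<close> must not be unfolded.\<close>

definition bd :: "'a \<Rightarrow> 'a \<Rightarrow> ('a \<times> 'a) option" where
  "bd x y = Some (x, y)"

context two_category
begin

text \<open>The value \<open>None\<close> off the 1-cells lets a single equation carry both
  membership and the two ends.\<close>

definition ty1 :: "'m \<Rightarrow> ('o \<times> 'o) option" where
  "ty1 f = (if f \<in> Arr K then bd (Src K f) (Tgt K f) else None)"

definition ty2 :: "'c \<Rightarrow> ('m \<times> 'm) option" where
  "ty2 \<alpha> = (if \<alpha> \<in> Cell K then bd (Dom K \<alpha>) (Cod K \<alpha>) else None)"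

lemma hom1_ty: "f \<in> hom1 K A B \<longleftrightarrow> ty1 f = bd A B"
  by (simp add: hom1_def ty1_def bd_def)

lemma hom2_ty: "\<alpha> \<in> hom2 K f g \<longleftrightarrow> ty2 \<alpha> = bd f g"
  by (simp add: hom2_def ty2_def bd_def)

lemma ty1_iff: "ty1 f = bd A B \<longleftrightarrow> f \<in> Arr K \<and> Src K f = A \<and> Tgt K f = B"
  by (simp add: hom1_def flip: hom1_ty)

lemma ty2_iff: "ty2 \<alpha> = bd f g \<longleftrightarrow> \<alpha> \<in> Cell K \<and> Dom K \<alpha> = f \<and> Cod K \<alpha> = g"
  by (simp add: hom2_def flip: hom2_ty)

lemma ty1D: "ty1 f = bd A B \<Longrightarrow> f \<in> Arr K" "ty1 f = bd A B \<Longrightarrow> Src K f = A"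
  "ty1 f = bd A B \<Longrightarrow> Tgt K f = B" "ty1 f = bd A B \<Longrightarrow> A \<in> Obj K" "ty1 f = bd A B \<Longrightarrow> B \<in> Obj K"
  by (auto simp: ty1_iff intro: Src_Obj Tgt_Obj)

lemma ty2D:
  assumes "ty2 \<alpha> = bd f g"
  shows "\<alpha> \<in> Cell K" "Dom K \<alpha> = f" "Cod K \<alpha> = g" "ty1 f = bd (Src K f) (Tgt K f)"
    "ty1 g = bd (Src K f) (Tgt K f)"
  using assms by (auto simp: ty1_iff ty2_iff intro: Dom_Arr Cod_Arr Src_Cod Tgt_Cod)

text \<open>The two boundaries of a 2-cell are parallel. This supplies the typing of the second
  boundary to lemmas whose hypotheses type only the first.\<close>

lemma ty2_arr:
  assumes "ty2 \<alpha> = bd f g"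
  shows "ty1 f = bd A B \<Longrightarrow> ty1 g = bd A B" "ty1 g = bd A B \<Longrightarrow> ty1 f = bd A B"
  using ty2D[OF assms] by (auto simp: ty1_iff)

lemmas ty_Id1 [simp] = Id1_hom[unfolded hom1_ty]
lemmas ty_Comp1 [simp] = Comp1_hom[unfolded hom1_ty]
lemmas Comp1_assoc' [simp] = Comp1_assoc[unfolded hom1_ty]
lemmas Comp1_Id1 [simp] = Id1_left[unfolded hom1_ty] Id1_right[unfolded hom1_ty]

lemma ty_Id2 [simp]: "ty1 f = bd A B \<Longrightarrow> ty2 (Id2 K f) = bd f f"
  using Id2_hom by (simp add: hom2_ty ty1_iff)

lemmas ty_VComp [simp] = VComp_hom[unfolded hom2_ty]
lemmas VComp_assoc' [simp] = VComp_assoc[unfolded hom2_ty]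
lemmas VComp_Id2 [simp] = Id2_left[unfolded hom2_ty] Id2_right[unfolded hom2_ty]
lemmas ty_HComp = HComp_hom[unfolded hom1_ty hom2_ty]
lemmas HComp_assoc' = HComp_assoc[unfolded hom1_ty hom2_ty]
lemmas interchange' = interchange[unfolded hom1_ty hom2_ty]
lemmas HComp_Id2' = HComp_Id2[unfolded hom1_ty]

lemma ty_whisker [simp]:
  assumes "ty2 \<alpha> = bd f g" "ty1 f = bd A B"
  shows "ty1 h = bd B X \<Longrightarrow> ty2 (h \<lhd> \<alpha>) = bd (h \<odot> f) (h \<odot> g)"
    "ty1 k = bd Y A \<Longrightarrow> ty2 (\<alpha> \<rhd> k) = bd (f \<odot> k) (g \<odot> k)"
  unfolding whisker_left_def whisker_right_def using assms by (auto intro!: ty_HComp)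

lemma whisker_VComp [simp]:
  assumes "ty2 \<alpha> = bd f g" "ty2 \<beta> = bd g h" "ty1 f = bd A B"
  shows "ty1 k = bd B X \<Longrightarrow> k \<lhd> (\<beta> \<bullet> \<alpha>) = (k \<lhd> \<beta>) \<bullet> (k \<lhd> \<alpha>)"
    "ty1 k' = bd Y A \<Longrightarrow> (\<beta> \<bullet> \<alpha>) \<rhd> k' = (\<beta> \<rhd> k') \<bullet> (\<alpha> \<rhd> k')"
  using assms interchange'[of f A B k X \<alpha> g \<beta> h "Id2 K k" k "Id2 K k" k]
    interchange'[of k' Y A f B "Id2 K k'" k' "Id2 K k'" k' \<alpha> g \<beta> h]
  by (simp_all add: whisker_left_def whisker_right_def)

lemma whisker_Id2 [simp]:
  assumes "ty1 f = bd A B" "ty1 g = bd B X"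
  shows "g \<lhd> Id2 K f = Id2 K (g \<odot> f)" "Id2 K g \<rhd> f = Id2 K (g \<odot> f)"
  using assms HComp_Id2' by (auto simp: whisker_left_def whisker_right_def)

lemma whisker_Id1 [simp]:
  assumes "ty2 \<alpha> = bd f g" "ty1 f = bd A B"
  shows "Id1 K B \<lhd> \<alpha> = \<alpha>" "\<alpha> \<rhd> Id1 K A = \<alpha>"
  using assms HComp_Id1_left HComp_Id1_right
  by (auto simp: whisker_left_def whisker_right_def hom1_ty hom2_ty)

lemma whisker_Comp1 [simp]:
  assumes "ty2 \<alpha> = bd f g" "ty1 f = bd A B"
  shows "ty1 h = bd B X \<Longrightarrow> ty1 k = bd X Y \<Longrightarrow> (k \<odot> h) \<lhd> \<alpha> = k \<lhd> (h \<lhd> \<alpha>)"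
    and "ty1 h' = bd X' A \<Longrightarrow> ty1 k' = bd Y' X' \<Longrightarrow> \<alpha> \<rhd> (h' \<odot> k') = (\<alpha> \<rhd> h') \<rhd> k'"
    and "ty1 h = bd B X \<Longrightarrow> ty1 k' = bd Y' A \<Longrightarrow> (h \<lhd> \<alpha>) \<rhd> k' = h \<lhd> (\<alpha> \<rhd> k')"
  using assms HComp_assoc'[of f A B h X k Y \<alpha> g "Id2 K h" h "Id2 K k" k]
    HComp_assoc'[of k' Y' X' h' A f B "Id2 K k'" k' "Id2 K h'" h' \<alpha> g]
    HComp_assoc'[of k' Y' A f B h X "Id2 K k'" k' \<alpha> g "Id2 K h" h]
  by (simp_all add: whisker_left_def whisker_right_def HComp_Id2')

text \<open>Interchange with identities in two of the four places. It trades \<star> for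
  whiskerings, the only horizontal operations that the normal form handles.\<close>

lemma HComp_whisker:
  assumes "ty2 \<alpha> = bd f f'" "ty2 \<beta> = bd g g'" "ty1 f = bd A B" "ty1 g = bd B X"
  shows "\<beta> \<star> \<alpha> = (\<beta> \<rhd> f') \<bullet> (g \<lhd> \<alpha>)"
  using interchange'[of f A B g X \<alpha> f' "Id2 K f'" f' "Id2 K g" g \<beta> g'] assms
    ty2_arr(1)[OF assms(1,3)]
  by (simp add: whisker_left_def whisker_right_def)

text \<open>Both sides are \<beta> \<star> \<alpha> by interchange.\<close>

lemma whisker_exchange:
  assumes "ty2 \<alpha> = bd f f'" "ty2 \<beta> = bd g g'" "ty1 f = bd A B" "ty1 g = bd B X"
  shows "(g' \<lhd> \<alpha>) \<bullet> (\<beta> \<rhd> f) = (\<beta> \<rhd> f') \<bullet> (g \<lhd> \<alpha>)"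
  using interchange'[of f A B g X "Id2 K f" f \<alpha> f' \<beta> g' "Id2 K g'" g'] HComp_whisker[OF assms] assms
    ty2_arr(1)[OF assms(2,4)]
  by (simp add: whisker_left_def whisker_right_def)

text \<open>In a chain associated to the right two neighbouring factors do not form a subterm unless
  they come last; this makes an equation about two factors usable in front of a further
  factor.\<close>

lemma VComp_extend:
  assumes "\<beta> \<bullet> \<alpha> = \<delta>" "ty2 \<alpha> = bd f g" "ty2 \<beta> = bd g h" "ty2 \<xi> = bd k f"
  shows "\<beta> \<bullet> \<alpha> \<bullet> \<xi> = \<delta> \<bullet> \<xi>"
  using assms VComp_assoc' by metis

section \<open>Invertible 2-cells and cancellation\<close>

definition invertible :: "'c \<Rightarrow> bool" where
  "invertible \<alpha> \<longleftrightarrow> (\<exists>\<beta>. inverse2 K \<alpha> \<beta>)"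

lemma iso2_ty: "\<alpha> \<in> iso2 K f g \<longleftrightarrow> ty2 \<alpha> = bd f g \<and> invertible \<alpha>"
  by (auto simp: iso2_def hom2_ty invertible_def)

lemma inverse2_ty:
  "ty2 \<alpha> = bd f g \<Longrightarrow> inverse2 K \<alpha> \<beta> \<longleftrightarrow> ty2 \<beta> = bd g f \<and> \<beta> \<bullet> \<alpha> = Id2 K f \<and> \<alpha> \<bullet> \<beta> = Id2 K g"
  by (auto simp: inverse2_def hom2_ty ty2_iff)

lemma inverse2_unique:
  assumes "ty2 \<alpha> = bd f g" "inverse2 K \<alpha> \<beta>" "inverse2 K \<alpha> \<beta>'"
  shows "\<beta>' = \<beta>"
proof -
  have "\<beta>' = (\<beta> \<bullet> \<alpha>) \<bullet> \<beta>'"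
    using assms(2,3) by (simp add: inverse2_ty[OF assms(1)])
  also have "\<dots> = \<beta> \<bullet> \<alpha> \<bullet> \<beta>'"
    using assms by (intro VComp_assoc') (auto simp: inverse2_ty)
  also have "\<dots> = \<beta>"
    using assms by (simp add: inverse2_ty)
  finally show ?thesis .
qed

lemma inv2_eqI:
  assumes "ty2 \<alpha> = bd f g" "ty2 \<beta> = bd g f" "\<beta> \<bullet> \<alpha> = Id2 K f" "\<alpha> \<bullet> \<beta> = Id2 K g"
  shows "invertible \<alpha>" "inv2 \<alpha> = \<beta>"
proof -
  have *: "inverse2 K \<alpha> \<beta>" using assms by (simp add: inverse2_ty)
  then show "invertible \<alpha>" by (auto simp: invertible_def)
  show "inv2 \<alpha> = \<beta>"
    unfolding inv2_def using assms(1) * inverse2_unique by (intro the_equality) auto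
qed

lemma inv2_props:
  assumes "ty2 \<alpha> = bd f g" "invertible \<alpha>"
  shows "ty2 (inv2 \<alpha>) = bd g f" "inv2 \<alpha> \<bullet> \<alpha> = Id2 K f" "\<alpha> \<bullet> inv2 \<alpha> = Id2 K g"
proof -
  obtain \<beta> where "inverse2 K \<alpha> \<beta>" using assms(2) by (auto simp: invertible_def)
  with inv2_eqI[OF assms(1), of \<beta>] inverse2_ty[OF assms(1)] have "inverse2 K \<alpha> (inv2 \<alpha>)" by auto
  then show "ty2 (inv2 \<alpha>) = bd g f" "inv2 \<alpha> \<bullet> \<alpha> = Id2 K f" "\<alpha> \<bullet> inv2 \<alpha> = Id2 K g"
    using inverse2_ty[OF assms(1)] by auto
qed

lemmas ty_inv2 [simp] = inv2_props(1)

text \<open>Cancellation of inverses under whiskering: in the normal form of 2-cells whiskerings are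
  pushed onto the factors, so that \<open>inv2\<close> is not the outermost operation.\<close>

definition cancelling :: "'c \<Rightarrow> 'c \<Rightarrow> bool" where
  "cancelling \<beta> \<alpha> \<longleftrightarrow> (\<exists>f g. ty2 \<alpha> = bd f g \<and> ty2 \<beta> = bd g f \<and> \<beta> \<bullet> \<alpha> = Id2 K f)"

lemma cancelling_ty:
  "ty2 \<alpha> = bd f g \<Longrightarrow> cancelling \<beta> \<alpha> \<longleftrightarrow> ty2 \<beta> = bd g f \<and> \<beta> \<bullet> \<alpha> = Id2 K f"
  by (auto simp: cancelling_def bd_def)

lemma cancelling_inv2 [simp]:
  assumes "invertible \<alpha>" "ty2 \<alpha> = bd f g"
  shows "cancelling \<alpha> (inv2 \<alpha>)" "cancelling (inv2 \<alpha>) \<alpha>"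
  using assms inv2_props by (auto simp: cancelling_def)

lemma cancelling_whisker [simp]:
  assumes "cancelling \<beta> \<alpha>" "ty2 \<alpha> = bd f g" "ty1 f = bd A B"
  shows "ty1 h = bd B X \<Longrightarrow> cancelling (h \<lhd> \<beta>) (h \<lhd> \<alpha>)"
    "ty1 k = bd Y A \<Longrightarrow> cancelling (\<beta> \<rhd> k) (\<alpha> \<rhd> k)"
proof -
  have *: "\<beta> \<bullet> \<alpha> = Id2 K f" and \<beta>: "ty2 \<beta> = bd g f"
    using assms by (auto simp: cancelling_ty)
  have g: "ty1 g = bd A B" using assms ty2_arr by blast
  show "cancelling (h \<lhd> \<beta>) (h \<lhd> \<alpha>)" if h: "ty1 h = bd B X"
    unfolding cancelling_def
    using whisker_VComp(1)[OF assms(2) \<beta> assms(3) h] * assms(2,3) \<beta> h g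
    by (intro exI[of _ "h \<odot> f"] exI[of _ "h \<odot> g"]) simp
  show "cancelling (\<beta> \<rhd> k) (\<alpha> \<rhd> k)" if k: "ty1 k = bd Y A"
    unfolding cancelling_def
    using whisker_VComp(2)[OF assms(2) \<beta> assms(3) k] * assms(2,3) \<beta> k g
    by (intro exI[of _ "f \<odot> k"] exI[of _ "g \<odot> k"]) simp
qed

text \<open>The second rule is the one for a pair that is followed by more factors in a right-nested
  chain.\<close>

lemma VComp_cancelling [simp]:
  assumes "cancelling \<beta> \<alpha>" "ty2 \<alpha> = bd f g"
  shows "\<beta> \<bullet> \<alpha> = Id2 K f" "ty2 \<xi> = bd k f \<Longrightarrow> \<beta> \<bullet> \<alpha> \<bullet> \<xi> = \<xi>"
  using assms VComp_extend[of \<beta> \<alpha> _ f g f \<xi> k] by (auto simp: cancelling_ty)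

lemma invertible_inv2 [simp]:
  assumes "ty2 \<alpha> = bd f g" "invertible \<alpha>"
  shows "invertible (inv2 \<alpha>)" "inv2 (inv2 \<alpha>) = \<alpha>"
  using inv2_eqI[of "inv2 \<alpha>" g f \<alpha>] inv2_props[OF assms] assms by auto

lemma invertible_Id2 [simp]:
  assumes "ty1 f = bd A B"
  shows "invertible (Id2 K f)" "inv2 (Id2 K f) = Id2 K f"
  using inv2_eqI[of "Id2 K f" f f "Id2 K f"] VComp_Id2(1)[of "Id2 K f"] assms by auto

lemma invertible_VComp [simp]:
  assumes "ty2 \<alpha> = bd f g" "ty2 \<beta> = bd g h" "invertible \<alpha>" "invertible \<beta>"
  shows "invertible (\<beta> \<bullet> \<alpha>)" "inv2 (\<beta> \<bullet> \<alpha>) = inv2 \<alpha> \<bullet> inv2 \<beta>"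
  using inv2_eqI[of "\<beta> \<bullet> \<alpha>" f h "inv2 \<alpha> \<bullet> inv2 \<beta>"] assms by auto

lemma invertible_whisker [simp]:
  assumes "ty2 \<alpha> = bd f g" "ty1 f = bd A B" "invertible \<alpha>"
  shows "ty1 h = bd B X \<Longrightarrow> invertible (h \<lhd> \<alpha>)" "ty1 h = bd B X \<Longrightarrow> inv2 (h \<lhd> \<alpha>) = h \<lhd> inv2 \<alpha>"
    "ty1 k = bd Y A \<Longrightarrow> invertible (\<alpha> \<rhd> k)" "ty1 k = bd Y A \<Longrightarrow> inv2 (\<alpha> \<rhd> k) = inv2 \<alpha> \<rhd> k"
proof -
  have g: "ty1 g = bd A B" using assms ty2_arr by blast
  show "ty1 h = bd B X \<Longrightarrow> invertible (h \<lhd> \<alpha>)" "ty1 h = bd B X \<Longrightarrow> inv2 (h \<lhd> \<alpha>) = h \<lhd> inv2 \<alpha>"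
    "ty1 k = bd Y A \<Longrightarrow> invertible (\<alpha> \<rhd> k)" "ty1 k = bd Y A \<Longrightarrow> inv2 (\<alpha> \<rhd> k) = inv2 \<alpha> \<rhd> k"
    using inv2_eqI[of "h \<lhd> \<alpha>" "h \<odot> f" "h \<odot> g" "h \<lhd> inv2 \<alpha>"]
      inv2_eqI[of "\<alpha> \<rhd> k" "f \<odot> k" "g \<odot> k" "inv2 \<alpha> \<rhd> k"] assms g by simp_all
qed

text \<open>Invertible cells are epimorphic. This is what permits comparing two pastings after
  precomposition with compositors.\<close>

lemma VComp_cancel_right:
  assumes "\<alpha> \<bullet> \<sigma> = \<beta> \<bullet> \<sigma>" "ty2 \<sigma> = bd f g" "invertible \<sigma>" "ty2 \<alpha> = bd g h" "ty2 \<beta> = bd g h'"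
  shows "\<alpha> = \<beta>"
proof -
  have "(\<alpha> \<bullet> \<sigma>) \<bullet> inv2 \<sigma> = (\<beta> \<bullet> \<sigma>) \<bullet> inv2 \<sigma>" using assms by simp
  then show ?thesis using assms(2-) by simp
qed

text \<open>The coherence axioms have the form "unknown cell after a compositor or unitor"; this
  solves them for the unknown cell.\<close>

lemma eq_VComp_inv2I:
  assumes "\<alpha> \<bullet> \<sigma> = \<beta>" "ty2 \<sigma> = bd f g" "invertible \<sigma>" "ty2 \<alpha> = bd g h"
  shows "\<alpha> = \<beta> \<bullet> inv2 \<sigma>"
  using assms by auto

end

section \<open>Pseudofunctors and pseudonatural transformations\<close>

context pseudofunctor
begin

lemmas ty_Map [simp] = Map1_hom[unfolded C.hom1_ty D.hom1_ty] Map2_hom[unfolded C.hom2_ty D.hom2_ty]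
lemmas Map2_VComp' [simp] = Map2_VComp[unfolded C.hom2_ty]

declare Map0_Obj [simp]

lemma Map2_Id' [simp]: "C.ty1 f = bd A B \<Longrightarrow> Map2 F (Id2 C f) = Id2 D (Map1 F f)"
  using Map2_Id by (auto simp: C.ty1_iff)

lemma Map2_inv2 [simp]:
  assumes "C.ty2 \<alpha> = bd f g" "C.invertible \<alpha>"
  shows "D.invertible (Map2 F \<alpha>)" "Map2 F (inv2\<^bsub>C\<^esub> \<alpha>) = inv2 (Map2 F \<alpha>)"
proof -
  note [simp] = C.inv2_props[OF assms] C.ty2D(4,5)[OF assms(1)] assms
  have 1: "Map2 F (inv2\<^bsub>C\<^esub> \<alpha>) \<bullet> Map2 F \<alpha> = Id2 D (Map1 F f)"
    "Map2 F \<alpha> \<bullet> Map2 F (inv2\<^bsub>C\<^esub> \<alpha>) = Id2 D (Map1 F g)"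
    by (simp_all flip: Map2_VComp')
  show "D.invertible (Map2 F \<alpha>)" "Map2 F (inv2\<^bsub>C\<^esub> \<alpha>) = inv2 (Map2 F \<alpha>)"
    using D.inv2_eqI[OF _ _ 1] by auto
qed

lemmas ty_Kap [simp] = conjunct1[OF Kap_iso[unfolded C.hom1_ty D.iso2_ty]]
  conjunct2[OF Kap_iso[unfolded C.hom1_ty D.iso2_ty]]

lemmas ty_Ups [simp] = conjunct1[OF Ups_iso[unfolded D.iso2_ty]] conjunct2[OF Ups_iso[unfolded D.iso2_ty]]

text \<open>Naturality of the compositor against an identity 2-cell, which the pseudofunctor
  preserves strictly.\<close>

lemma Map2_whisker:
  assumes "C.ty2 \<alpha> = bd f g" "C.ty1 f = bd A B"
  shows "C.ty1 h = bd B X \<Longrightarrow> Map2 F (h \<lhd>\<^bsub>C\<^esub> \<alpha>) =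
      Kap F h g \<bullet> (Map1 F h \<lhd> Map2 F \<alpha>) \<bullet> inv2 (Kap F h f)"
    and "C.ty1 k = bd Y A \<Longrightarrow> Map2 F (\<alpha> \<rhd>\<^bsub>C\<^esub> k) =
      Kap F g k \<bullet> (Map2 F \<alpha> \<rhd> Map1 F k) \<bullet> inv2 (Kap F f k)"
proof -
  note [simp] = assms C.ty2_arr(1)[OF assms]
  assume [simp]: "C.ty1 h = bd B X"
  have "Map2 F (h \<lhd>\<^bsub>C\<^esub> \<alpha>) \<bullet> Kap F h f = Kap F h g \<bullet> (Map1 F h \<lhd> Map2 F \<alpha>)"
    using Kap_nat[of f A B h X \<alpha> g "Id2 C h" h]
    by (simp add: whisker_left_def C.hom1_ty C.hom2_ty)
  from D.eq_VComp_inv2I[OF this] show "Map2 F (h \<lhd>\<^bsub>C\<^esub> \<alpha>) =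
      Kap F h g \<bullet> (Map1 F h \<lhd> Map2 F \<alpha>) \<bullet> inv2 (Kap F h f)"
    by simp
next
  note [simp] = assms C.ty2_arr(1)[OF assms]
  assume [simp]: "C.ty1 k = bd Y A"
  have "Map2 F (\<alpha> \<rhd>\<^bsub>C\<^esub> k) \<bullet> Kap F f k = Kap F g k \<bullet> (Map2 F \<alpha> \<rhd> Map1 F k)"
    using Kap_nat[of k Y A f B "Id2 C k" k \<alpha> g]
    by (simp add: whisker_right_def C.hom1_ty C.hom2_ty)
  from D.eq_VComp_inv2I[OF this] show "Map2 F (\<alpha> \<rhd>\<^bsub>C\<^esub> k) =
      Kap F g k \<bullet> (Map2 F \<alpha> \<rhd> Map1 F k) \<bullet> inv2 (Kap F f k)"
    by simp
qed

text \<open>Only a composite in the left argument is broken up. This agrees with the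
  right-associated normal form of \<odot>, so that the compositors of an iterated composite become
  comparable.\<close>

lemma Kap_Comp1_left:
  assumes [simp]: "C.ty1 f = bd A B" "C.ty1 g = bd B X" "C.ty1 h = bd X Y"
  shows "Kap F (h \<odot>\<^bsub>C\<^esub> g) f =
    Kap F h (g \<odot>\<^bsub>C\<^esub> f) \<bullet> (Map1 F h \<lhd> Kap F g f) \<bullet> (inv2 (Kap F h g) \<rhd> Map1 F f)"
proof -
  have "Kap F (h \<odot>\<^bsub>C\<^esub> g) f \<bullet> (Kap F h g \<rhd> Map1 F f) = Kap F h (g \<odot>\<^bsub>C\<^esub> f) \<bullet> (Map1 F h \<lhd> Kap F g f)"
    using Kap_assoc[of f A B g X h Y] by (simp add: C.hom1_ty)
  from D.eq_VComp_inv2I[OF this] show ?thesis by simp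
qed

lemma Kap_Id1:
  assumes [simp]: "C.ty1 f = bd A B"
  shows "Kap F f (Id1 C A) = Map1 F f \<lhd> inv2 (Ups F A)"
    and "Kap F (Id1 C B) f = inv2 (Ups F B) \<rhd> Map1 F f"
proof -
  note [simp] = C.ty1D(4,5)[OF assms]
  have "Kap F f (Id1 C A) \<bullet> (Map1 F f \<lhd> Ups F A) = Id2 D (Map1 F f)"
    using Kap_Ups_right[of f A] by (simp add: C.hom1_ty)
  from D.eq_VComp_inv2I[OF this] show "Kap F f (Id1 C A) = Map1 F f \<lhd> inv2 (Ups F A)"
    by simp
  have "Kap F (Id1 C B) f \<bullet> (Ups F B \<rhd> Map1 F f) = Id2 D (Map1 F f)"
    using Kap_Ups_left[of f _ B] by (simp add: C.hom1_ty)
  from D.eq_VComp_inv2I[OF this] show "Kap F (Id1 C B) f = inv2 (Ups F B) \<rhd> Map1 F f"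
    by simp
qed

end

lemma id_psf_sel [simp]:
  "Map0 (id_psf C) A = A" "Map1 (id_psf C) f = f" "Map2 (id_psf C) \<alpha> = \<alpha>"
  "Kap (id_psf C) g f = Id2 C (g \<odot>\<^bsub>C\<^esub> f)" "Ups (id_psf C) A = Id2 C (Id1 C A)"
  by (simp_all add: id_psf_def)

lemma comp_psf_sel [simp]:
  "Map0 (comp_psf E G F) A = Map0 G (Map0 F A)"
  "Map1 (comp_psf E G F) f = Map1 G (Map1 F f)"
  "Map2 (comp_psf E G F) \<alpha> = Map2 G (Map2 F \<alpha>)"
  "Kap (comp_psf E G F) g f = Map2 G (Kap F g f) \<bullet>\<^bsub>E\<^esub> Kap G (Map1 F g) (Map1 F f)"
  "Ups (comp_psf E G F) A = Map2 G (Ups F A) \<bullet>\<^bsub>E\<^esub> Ups G (Map0 F A)"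
  by (simp_all add: comp_psf_def)

lemma pst_sel [simp]:
  "Cmp (id_pst D T) X = Id1 D (Map0 T X)"
  "Str (id_pst D T) f = Id2 D (Map1 T f)"
  "Cmp (comp_pst C D \<beta> \<alpha>) X = Cmp \<beta> X \<odot>\<^bsub>D\<^esub> Cmp \<alpha> X"
  "Str (comp_pst C D \<beta> \<alpha>) f =
     (Str \<beta> f \<rhd>\<^bsub>D\<^esub> Cmp \<alpha> (Src C f)) \<bullet>\<^bsub>D\<^esub> (Cmp \<beta> (Tgt C f) \<lhd>\<^bsub>D\<^esub> Str \<alpha> f)"
  "Cmp (pre_pst \<alpha>' F) X = Cmp \<alpha>' (Map0 F X)"
  "Str (pre_pst \<alpha>' F) f = Str \<alpha>' (Map1 F f)"
  "Cmp (post_pst C E G S T \<alpha>) X = Map1 G (Cmp \<alpha> X)"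
  "Str (post_pst C E G S T \<alpha>) f = inv2\<^bsub>E\<^esub> (Kap G (Map1 T f) (Cmp \<alpha> (Src C f))) \<bullet>\<^bsub>E\<^esub>
     Map2 G (Str \<alpha> f) \<bullet>\<^bsub>E\<^esub> Kap G (Cmp \<alpha> (Tgt C f)) (Map1 S f)"
  by (simp_all add: id_pst_def comp_pst_def pre_pst_def post_pst_def)

context pseudonatural
begin

lemmas ty_Cmp [simp] = Cmp_hom[unfolded S.D.hom1_ty]
lemmas ty_Str [simp] = conjunct1[OF Nat_iso[unfolded S.C.hom1_ty S.D.iso2_ty]]
  conjunct2[OF Nat_iso[unfolded S.C.hom1_ty S.D.iso2_ty]]
lemmas Str_nat = Nat_nat[unfolded S.C.hom1_ty S.C.hom2_ty]

text \<open>For \<mu> the source is the composite of T with itself, so \<open>Kap S\<close> becomes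
  the two-step compositor that later proofs call \<open>k\<close>.\<close>

lemma Str_Comp1:
  assumes [simp]: "S.C.ty1 f = bd X Y" "S.C.ty1 g = bd Y Z"
  shows "Str \<alpha> (g \<odot>\<^bsub>C\<^esub> f) =
    (Kap T g f \<rhd> Cmp \<alpha> X) \<bullet> (Map1 T g \<lhd> Str \<alpha> f) \<bullet> (Str \<alpha> g \<rhd> Map1 S f) \<bullet>
    (Cmp \<alpha> Z \<lhd> inv2 (Kap S g f))"
proof -
  note [simp] = S.C.ty1D(4,5)[OF assms(1)] S.C.ty1D(4,5)[OF assms(2)]
  have "Str \<alpha> (g \<odot>\<^bsub>C\<^esub> f) \<bullet> (Cmp \<alpha> Z \<lhd> Kap S g f) =
      (Kap T g f \<rhd> Cmp \<alpha> X) \<bullet> (Map1 T g \<lhd> Str \<alpha> f) \<bullet> (Str \<alpha> g \<rhd> Map1 S f)"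
    by (intro Nat_Comp) (simp_all add: S.C.hom1_ty)
  from S.D.eq_VComp_inv2I[OF this] show ?thesis by simp
qed

lemma Str_Id1:
  assumes "X \<in> Obj C"
  shows "Str \<alpha> (Id1 C X) = (Ups T X \<rhd> Cmp \<alpha> X) \<bullet> (Cmp \<alpha> X \<lhd> inv2 (Ups S X))"
  using S.D.eq_VComp_inv2I[OF Nat_Id[OF assms]] assms by simp

end

lemmas (in invertible_modification) mod_ty =
  conjunct1[OF mod_iso[unfolded \<alpha>.S.D.iso2_ty]] conjunct2[OF mod_iso[unfolded \<alpha>.S.D.iso2_ty]]
lemmas (in modification) mod_nat' = mod_nat[unfolded \<alpha>.S.C.hom1_ty]

sublocale pseudomonad \<subseteq> T: pseudofunctor K K T
  by (rule T_pseudofunctor)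

sublocale pseudomonad \<subseteq> eta: pseudonatural K K "id_psf K" T "Eta M"
  by (rule eta_pseudonatural)

sublocale pseudomonad \<subseteq> mu: pseudonatural K K TT T "Mu M"
  by (rule mu_pseudonatural)

context pseudomonad
begin

declare eta.ty_Cmp [simplified, simp] eta.ty_Str [simplified, simp]
  mu.ty_Cmp [simplified, simp] mu.ty_Str [simplified, simp]

lemmas ty_run [simp] = invertible_modification.mod_ty[OF run_modification, simplified]
lemmas ty_asc [simp] = invertible_modification.mod_ty[OF asc_modification, simplified]

end

context pseudoalgebra
begin

lemma ty_alg [simp]:
  "Car A \<in> Obj K" "ty1 (Act A) = bd (T\<^sub>0 (Car A)) (Car A)"
  "ty2 (Iota A) = bd (Act A \<odot> \<eta> (Car A)) (Id1 K (Car A))" "invertible (Iota A)"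
  "ty2 (Gam A) = bd (Act A \<odot> T\<^sub>1 (Act A)) (Act A \<odot> \<mu> (Car A))" "invertible (Gam A)"
  using Car_Obj Act_hom Iota_iso Gam_iso by (auto simp: hom1_ty iso2_ty)

end

context pseudoalgebra_morphism
begin

lemma ty_mor [simp]:
  "A.ty1 f = bd (Car A) (Car B)"
  "A.ty2 \<phi> = bd (Act B \<odot> A.T\<^sub>1 f) (f \<odot> Act A)" "A.invertible \<phi>"
  using f_hom phi_iso by (auto simp: A.hom1_ty A.iso2_ty)

end

section \<open>The 2-category of pseudoalgebras\<close>

lemma (in pseudoalgebra) id_morphism:
  "pseudoalgebra_morphism K M A A (Id1 K (Car A)) (Act A \<lhd> inv2 (\<upsilon> (Car A)))"
proof (unfold_locales, goal_cases)
  case 1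
  show ?case by (simp add: hom1_ty)
next
  case 2
  show ?case by (simp add: iso2_ty)
next
  case 3
  show ?case by (simp add: eta.Str_Id1)
next
  case 4
  \<comment> \<open>The inverse unitor of the composite of T with itself; \<open>mu.Str_Id1\<close>
    puts it next to \<open>Gam A\<close>, past which it has to be moved.\<close>
  let ?k = "inv2 (\<upsilon> (T\<^sub>0 (Car A))) \<bullet> inv2 (T\<^sub>2 (\<upsilon> (Car A)))"
  have "((Act A \<odot> \<mu> (Car A)) \<lhd> ?k) \<bullet> (Gam A \<rhd> T\<^sub>1 (T\<^sub>1 (Id1 K (Car A)))) =
      (Gam A \<rhd> Id1 K (T\<^sub>0 (T\<^sub>0 (Car A)))) \<bullet> ((Act A \<odot> T\<^sub>1 (Act A)) \<lhd> ?k)"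
    by (rule whisker_exchange) simp_all
  then show ?case
    by (simp add: mu.Str_Id1 T.Map2_whisker T.Kap_Id1)
qed

text \<open>The squares of \<phi> and \<chi> are pasted side by side. Each law is the law of \<chi>
  whiskered with f and the law of \<phi> whiskered with g, joined by interchange.\<close>

lemma comp_morphism:
  fixes K (structure)
  assumes "pseudoalgebra_morphism K M A B f \<phi>" "pseudoalgebra_morphism K M B C g \<chi>"
  shows "pseudoalgebra_morphism K M A C (g \<odot> f)
    ((g \<lhd> \<phi>) \<bullet> (\<chi> \<rhd> Map1 (Fun M) f) \<bullet> (Act C \<lhd> inv2 (Kap (Fun M) g f)))"
proof -
  interpret F: pseudoalgebra_morphism K M A B f \<phi> by fact
  interpret G: pseudoalgebra_morphism K M B C g \<chi> by fact
  show ?thesis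
  proof (unfold_locales, goal_cases)
    case 1
    show ?case by (simp add: F.A.hom1_ty)
  next
    case 2
    show ?case by (simp add: F.A.iso2_ty)
  next
    case 3
    have "Iota C \<rhd> (g \<odot> f) = (Iota C \<rhd> g) \<rhd> f" by simp
    also have "\<dots> = (g \<lhd> (Iota B \<rhd> f)) \<bullet> (((\<chi> \<rhd> F.A.\<eta> (Car B)) \<bullet> (Act C \<lhd> F.A.\<eta>\<^sub>1 g)) \<rhd> f)"
      by (simp add: G.mor_unit_law)
    also have "\<dots> = (g \<lhd> ((f \<lhd> Iota A) \<bullet> (\<phi> \<rhd> F.A.\<eta> (Car A)) \<bullet> (Act B \<lhd> F.A.\<eta>\<^sub>1 f))) \<bullet>
        (((\<chi> \<rhd> F.A.\<eta> (Car B)) \<bullet> (Act C \<lhd> F.A.\<eta>\<^sub>1 g)) \<rhd> f)"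
      by (simp only: F.mor_unit_law)
    also have "\<dots> = (g \<lhd> ((f \<lhd> Iota A) \<bullet> (\<phi> \<rhd> F.A.\<eta> (Car A)))) \<bullet>
        (((g \<odot> Act B) \<lhd> F.A.\<eta>\<^sub>1 f) \<bullet> (\<chi> \<rhd> (F.A.\<eta> (Car B) \<odot> f))) \<bullet> ((Act C \<lhd> F.A.\<eta>\<^sub>1 g) \<rhd> f)"
      by simp
    also have "((g \<odot> Act B) \<lhd> F.A.\<eta>\<^sub>1 f) \<bullet> (\<chi> \<rhd> (F.A.\<eta> (Car B) \<odot> f)) =
        (\<chi> \<rhd> (F.A.T\<^sub>1 f \<odot> F.A.\<eta> (Car A))) \<bullet> ((Act C \<odot> F.A.T\<^sub>1 g) \<lhd> F.A.\<eta>\<^sub>1 f)"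
      by (rule F.A.whisker_exchange) simp_all
    finally show ?case by (simp add: F.A.eta.Str_Comp1)
  next
    case 4
    define X where "X = inv2 (F.A.\<kappa> f (Act A)) \<bullet> F.A.T\<^sub>2 \<phi> \<bullet> F.A.\<kappa> (Act B) (F.A.T\<^sub>1 f)"
    have X [simp]: "F.A.ty2 X = bd (F.A.T\<^sub>1 (Act B) \<odot> F.A.T\<^sub>1 (F.A.T\<^sub>1 f)) (F.A.T\<^sub>1 f \<odot> F.A.T\<^sub>1 (Act A))"
      by (simp add: X_def)
    define Y where "Y = inv2 (F.A.\<kappa> g (Act B)) \<bullet> F.A.T\<^sub>2 \<chi> \<bullet> F.A.\<kappa> (Act C) (F.A.T\<^sub>1 g)"
    have Y [simp]: "F.A.ty2 Y = bd (F.A.T\<^sub>1 (Act C) \<odot> F.A.T\<^sub>1 (F.A.T\<^sub>1 g)) (F.A.T\<^sub>1 g \<odot> F.A.T\<^sub>1 (Act B))"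
      by (simp add: Y_def)
    define k where "k = F.A.T\<^sub>2 (F.A.\<kappa> g f) \<bullet> F.A.\<kappa> (F.A.T\<^sub>1 g) (F.A.T\<^sub>1 f)"
    have k [simp]: "F.A.ty2 k = bd (F.A.T\<^sub>1 (F.A.T\<^sub>1 g) \<odot> F.A.T\<^sub>1 (F.A.T\<^sub>1 f)) (F.A.T\<^sub>1 (F.A.T\<^sub>1 (g \<odot> f)))"
      "F.A.invertible k"
      by (simp_all add: k_def)
    \<comment> \<open>Both sides of the law start at an image of the composite g \<odot> f under T
      twice; \<open>k\<close> splits it, so that the laws of the two morphisms can be applied
      separately.\<close>
    let ?\<sigma> = "Act C \<lhd> F.A.T\<^sub>1 (Act C) \<lhd> k"
    show ?case (is "?l = ?r")
    proof (rule F.A.VComp_cancel_right[of _ ?\<sigma>])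
      \<comment> \<open>The leading compositor on the right-hand side is the one that cancels the
        inverse compositor in the cell of the composite morphism.\<close>
      have T_comp: "inv2 (F.A.\<kappa> (g \<odot> f) (Act A)) \<bullet> F.A.T\<^sub>2 ((g \<lhd> \<phi>) \<bullet> (\<chi> \<rhd> F.A.T\<^sub>1 f) \<bullet> (Act C \<lhd> inv2 (F.A.\<kappa> g f))) \<bullet>
          F.A.\<kappa> (Act C) (F.A.T\<^sub>1 (g \<odot> f)) \<bullet> (F.A.T\<^sub>1 (Act C) \<lhd> k) =
        (F.A.\<kappa> g f \<rhd> F.A.T\<^sub>1 (Act A)) \<bullet> (F.A.T\<^sub>1 g \<lhd> X) \<bullet> (Y \<rhd> F.A.T\<^sub>1 (F.A.T\<^sub>1 f))"
        by (simp add: k_def X_def Y_def F.A.T.Map2_whisker F.A.T.Kap_Comp1_left)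
      have "?l \<bullet> ?\<sigma> = ((g \<odot> f) \<lhd> Gam A) \<bullet> (g \<lhd> \<phi> \<rhd> F.A.T\<^sub>1 (Act A)) \<bullet>
         (\<chi> \<rhd> (F.A.T\<^sub>1 f \<odot> F.A.T\<^sub>1 (Act A))) \<bullet> (Act C \<lhd> (inv2 (F.A.\<kappa> g f) \<rhd> F.A.T\<^sub>1 (Act A))) \<bullet>
         (Act C \<lhd> (inv2 (F.A.\<kappa> (g \<odot> f) (Act A)) \<bullet> F.A.T\<^sub>2 ((g \<lhd> \<phi>) \<bullet> (\<chi> \<rhd> F.A.T\<^sub>1 f) \<bullet> (Act C \<lhd> inv2 (F.A.\<kappa> g f))) \<bullet>
          F.A.\<kappa> (Act C) (F.A.T\<^sub>1 (g \<odot> f)) \<bullet> (F.A.T\<^sub>1 (Act C) \<lhd> k)))" by simp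
      also have "\<dots> = ((g \<odot> f) \<lhd> Gam A) \<bullet> (g \<lhd> \<phi> \<rhd> F.A.T\<^sub>1 (Act A)) \<bullet>
         (\<chi> \<rhd> (F.A.T\<^sub>1 f \<odot> F.A.T\<^sub>1 (Act A))) \<bullet> ((Act C \<odot> F.A.T\<^sub>1 g) \<lhd> X) \<bullet>
         (Act C \<lhd> Y \<rhd> F.A.T\<^sub>1 (F.A.T\<^sub>1 f))"
        by (simp only: T_comp) simp
      also have "\<dots> = ((g \<odot> f) \<lhd> Gam A) \<bullet> (g \<lhd> \<phi> \<rhd> F.A.T\<^sub>1 (Act A)) \<bullet>
         ((\<chi> \<rhd> (F.A.T\<^sub>1 f \<odot> F.A.T\<^sub>1 (Act A))) \<bullet> ((Act C \<odot> F.A.T\<^sub>1 g) \<lhd> X)) \<bullet>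
         (Act C \<lhd> Y \<rhd> F.A.T\<^sub>1 (F.A.T\<^sub>1 f))"
        by simp
      also have "(\<chi> \<rhd> (F.A.T\<^sub>1 f \<odot> F.A.T\<^sub>1 (Act A))) \<bullet> ((Act C \<odot> F.A.T\<^sub>1 g) \<lhd> X) =
        ((g \<odot> Act B) \<lhd> X) \<bullet> (\<chi> \<rhd> (F.A.T\<^sub>1 (Act B) \<odot> F.A.T\<^sub>1 (F.A.T\<^sub>1 f)))"
        by (rule F.A.whisker_exchange[symmetric]) simp_all
      also have "((g \<odot> f) \<lhd> Gam A) \<bullet> (g \<lhd> \<phi> \<rhd> F.A.T\<^sub>1 (Act A)) \<bullet> \<dots> \<bullet>
          (Act C \<lhd> Y \<rhd> F.A.T\<^sub>1 (F.A.T\<^sub>1 f)) =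
        (g \<lhd> ((f \<lhd> Gam A) \<bullet> (\<phi> \<rhd> F.A.T\<^sub>1 (Act A)) \<bullet> (Act B \<lhd> X))) \<bullet>
        (((\<chi> \<rhd> F.A.T\<^sub>1 (Act B)) \<bullet> (Act C \<lhd> Y)) \<rhd> F.A.T\<^sub>1 (F.A.T\<^sub>1 f))"
        by simp
      also have "\<dots> = (g \<lhd> ((\<phi> \<rhd> F.A.\<mu> (Car A)) \<bullet> (Act B \<lhd> F.A.\<mu>\<^sub>1 f))) \<bullet>
        (((g \<lhd> Gam B) \<bullet> (\<chi> \<rhd> F.A.T\<^sub>1 (Act B)) \<bullet> (Act C \<lhd> Y)) \<rhd> F.A.T\<^sub>1 (F.A.T\<^sub>1 f))"
        by (simp only: F.mor_assoc_law[folded X_def]) simp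
      also have "\<dots> = (g \<lhd> (\<phi> \<rhd> F.A.\<mu> (Car A))) \<bullet>
        (((g \<odot> Act B) \<lhd> F.A.\<mu>\<^sub>1 f) \<bullet> (\<chi> \<rhd> (F.A.\<mu> (Car B) \<odot> F.A.T\<^sub>1 (F.A.T\<^sub>1 f)))) \<bullet>
        (((Act C \<lhd> F.A.\<mu>\<^sub>1 g) \<bullet> (Gam C \<rhd> F.A.T\<^sub>1 (F.A.T\<^sub>1 g))) \<rhd> F.A.T\<^sub>1 (F.A.T\<^sub>1 f))"
        by (simp only: G.mor_assoc_law[folded Y_def]) simp
      also have "((g \<odot> Act B) \<lhd> F.A.\<mu>\<^sub>1 f) \<bullet> (\<chi> \<rhd> (F.A.\<mu> (Car B) \<odot> F.A.T\<^sub>1 (F.A.T\<^sub>1 f))) =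
        (\<chi> \<rhd> (F.A.T\<^sub>1 f \<odot> F.A.\<mu> (Car A))) \<bullet> ((Act C \<odot> F.A.T\<^sub>1 g) \<lhd> F.A.\<mu>\<^sub>1 f)"
        by (rule F.A.whisker_exchange) simp_all
      \<comment> \<open>Inserts \<open>inv2 k\<close> after \<open>k\<close>. The former completes
        the expansion of \<mu> at g \<odot> f; the latter is moved past \<open>Gam C\<close> and
        becomes \<open>?\<sigma>\<close>.\<close>
      also have "(g \<lhd> (\<phi> \<rhd> F.A.\<mu> (Car A))) \<bullet> \<dots> \<bullet>
        (((Act C \<lhd> F.A.\<mu>\<^sub>1 g) \<bullet> (Gam C \<rhd> F.A.T\<^sub>1 (F.A.T\<^sub>1 g))) \<rhd> F.A.T\<^sub>1 (F.A.T\<^sub>1 f)) =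
        (g \<lhd> (\<phi> \<rhd> F.A.\<mu> (Car A))) \<bullet> (\<chi> \<rhd> (F.A.T\<^sub>1 f \<odot> F.A.\<mu> (Car A))) \<bullet>
        (Act C \<lhd> (((F.A.T\<^sub>1 g \<lhd> F.A.\<mu>\<^sub>1 f) \<bullet> (F.A.\<mu>\<^sub>1 g \<rhd> F.A.T\<^sub>1 (F.A.T\<^sub>1 f)) \<bullet> (F.A.\<mu> (Car C) \<lhd> inv2 k)))) \<bullet>
          ((Act C \<odot> F.A.\<mu> (Car C)) \<lhd> k) \<bullet> (Gam C \<rhd> (F.A.T\<^sub>1 (F.A.T\<^sub>1 g) \<odot> F.A.T\<^sub>1 (F.A.T\<^sub>1 f)))"
        by simp
      also have "((Act C \<odot> F.A.\<mu> (Car C)) \<lhd> k) \<bullet> (Gam C \<rhd> (F.A.T\<^sub>1 (F.A.T\<^sub>1 g) \<odot> F.A.T\<^sub>1 (F.A.T\<^sub>1 f))) =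
          (Gam C \<rhd> F.A.T\<^sub>1 (F.A.T\<^sub>1 (g \<odot> f))) \<bullet> ((Act C \<odot> F.A.T\<^sub>1 (Act C)) \<lhd> k)"
        by (rule F.A.whisker_exchange) simp_all
      also have "(g \<lhd> (\<phi> \<rhd> F.A.\<mu> (Car A))) \<bullet> (\<chi> \<rhd> (F.A.T\<^sub>1 f \<odot> F.A.\<mu> (Car A))) \<bullet>
        (Act C \<lhd> (((F.A.T\<^sub>1 g \<lhd> F.A.\<mu>\<^sub>1 f) \<bullet> (F.A.\<mu>\<^sub>1 g \<rhd> F.A.T\<^sub>1 (F.A.T\<^sub>1 f)) \<bullet> (F.A.\<mu> (Car C) \<lhd> inv2 k)))) \<bullet>
          \<dots> = ?r \<bullet> ?\<sigma>"
        by (simp add: F.A.mu.Str_Comp1 k_def)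
      finally show "?l \<bullet> ?\<sigma> = ?r \<bullet> ?\<sigma>" .
    qed simp_all
  qed
qed

lemma (in pseudomonad_data) pseudoalgebras_sel [simp]:
  "Obj pseudoalgebras = {A. pseudoalgebra K M A}"
  "Arr pseudoalgebras = {F. is_mor F}" "Cell pseudoalgebras = {\<alpha>. is_cell \<alpha>}"
  "Src pseudoalgebras = MSrc" "Tgt pseudoalgebras = MTgt"
  "Dom pseudoalgebras = CDom" "Cod pseudoalgebras = CCod"
  "Id1 pseudoalgebras = id_mor" "Comp1 pseudoalgebras = comp_mor"
  "Id2 pseudoalgebras F = \<lparr>CDom = F, CCod = F, CCell = Id2 K (MArr F)\<rparr>"
  "VComp pseudoalgebras \<beta>' \<alpha>' = \<lparr>CDom = CDom \<alpha>', CCod = CCod \<beta>', CCell = CCell \<beta>' \<bullet> CCell \<alpha>'\<rparr>"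
  "HComp pseudoalgebras \<beta>' \<alpha>' = \<lparr>CDom = comp_mor (CDom \<beta>') (CDom \<alpha>'),
     CCod = comp_mor (CCod \<beta>') (CCod \<alpha>'), CCell = CCell \<beta>' \<star> CCell \<alpha>'\<rparr>"
  by (simp_all add: pseudoalgebras_def)

section \<open>The axioms of a 2-category\<close>

context pseudomonad
begin

lemma ty_psalg:
  assumes "pseudoalgebra K M A"
  shows "Car A \<in> Obj K" "ty1 (Act A) = bd (T\<^sub>0 (Car A)) (Car A)"
proof -
  interpret pseudoalgebra K M A by fact
  show "Car A \<in> Obj K" "ty1 (Act A) = bd (T\<^sub>0 (Car A)) (Car A)" by simp_all
qed

lemma ty_is_mor:
  assumes "is_mor F"
  shows "ty1 (MArr F) = bd (Car (MSrc F)) (Car (MTgt F))"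
    "ty2 (MCell F) = bd (Act (MTgt F) \<odot> T\<^sub>1 (MArr F)) (MArr F \<odot> Act (MSrc F))"
    "invertible (MCell F)" "pseudoalgebra K M (MSrc F)" "pseudoalgebra K M (MTgt F)"
proof -
  interpret F: pseudoalgebra_morphism K M "MSrc F" "MTgt F" "MArr F" "MCell F"
    using assms by (simp add: is_mor_def)
  show "ty1 (MArr F) = bd (Car (MSrc F)) (Car (MTgt F))"
    "ty2 (MCell F) = bd (Act (MTgt F) \<odot> T\<^sub>1 (MArr F)) (MArr F \<odot> Act (MSrc F))"
    "invertible (MCell F)" "pseudoalgebra K M (MSrc F)" "pseudoalgebra K M (MTgt F)"
    by (simp_all add: F.A.pseudoalgebra_axioms F.B.pseudoalgebra_axioms)
qed

lemmas ty_psmor = ty_is_mor ty_psalg[OF ty_is_mor(4)] ty_psalg[OF ty_is_mor(5)]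

lemma is_cellD:
  assumes "is_cell \<alpha>"
  shows "is_mor (CDom \<alpha>)" "is_mor (CCod \<alpha>)"
    "MSrc (CCod \<alpha>) = MSrc (CDom \<alpha>)" "MTgt (CCod \<alpha>) = MTgt (CDom \<alpha>)"
    "ty2 (CCell \<alpha>) = bd (MArr (CDom \<alpha>)) (MArr (CCod \<alpha>))"
    "(CCell \<alpha> \<rhd> Act (MSrc (CDom \<alpha>))) \<bullet> MCell (CDom \<alpha>) =
     MCell (CCod \<alpha>) \<bullet> (Act (MTgt (CDom \<alpha>)) \<lhd> T\<^sub>2 (CCell \<alpha>))"
  using assms by (auto simp: is_cell_def hom2_ty)

lemma is_mor_id_mor: "pseudoalgebra K M A \<Longrightarrow> is_mor (id_mor A)"
  by (simp add: is_mor_def id_mor_def pseudoalgebra.id_morphism)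

lemma is_mor_comp_mor: "is_mor F \<Longrightarrow> is_mor G \<Longrightarrow> MSrc G = MTgt F \<Longrightarrow> is_mor (comp_mor G F)"
  by (simp add: is_mor_def comp_mor_def comp_morphism)

lemma mor_sel [simp]:
  "MSrc (id_mor A) = A" "MTgt (id_mor A) = A" "MArr (id_mor A) = Id1 K (Car A)"
  "MSrc (comp_mor G F) = MSrc F" "MTgt (comp_mor G F) = MTgt G"
  "MArr (comp_mor G F) = MArr G \<odot> MArr F"
  by (simp_all add: id_mor_def comp_mor_def)

text \<open>Composition is strictly unital although T is not strict: the unit coherence of T cancels
  the compositor in \<open>comp_mor\<close> against the unitor in \<open>id_mor\<close>.\<close>

lemma comp_mor_id_mor:
  assumes "is_mor F"
  shows "comp_mor (id_mor (MTgt F)) F = F" "comp_mor F (id_mor (MSrc F)) = F"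
proof -
  note [simp] = ty_psmor[OF assms]
  have "((MArr F \<odot> Act (MSrc F)) \<lhd> inv2 (\<upsilon> (Car (MSrc F)))) \<bullet> (MCell F \<rhd> T\<^sub>1 (Id1 K (Car (MSrc F)))) =
      (MCell F \<rhd> Id1 K (T\<^sub>0 (Car (MSrc F)))) \<bullet>
      ((Act (MTgt F) \<odot> T\<^sub>1 (MArr F)) \<lhd> inv2 (\<upsilon> (Car (MSrc F))))"
    by (rule whisker_exchange) simp_all
  \<comment> \<open>By \<open>T.Kap_Id1\<close> this whiskered unitor is the inverse compositor that
    \<open>comp_mor\<close> contains when its second morphism is an identity.\<close>
  from VComp_extend[OF this, of _ _ _ "Act (MTgt F) \<lhd> T\<^sub>1 (MArr F) \<lhd> \<upsilon> (Car (MSrc F))"]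
  show "comp_mor F (id_mor (MSrc F)) = F"
    by (intro psalg_mor.equality) (simp_all add: comp_mor_def id_mor_def T.Kap_Id1)
  show "comp_mor (id_mor (MTgt F)) F = F"
    by (intro psalg_mor.equality) (simp_all add: comp_mor_def id_mor_def T.Kap_Id1)
qed

text \<open>Strict because the compositors of the two bracketings agree by
  \<open>T.Kap_Comp1_left\<close>, once the cell of H has been exchanged with the inner
  compositor.\<close>

lemma comp_mor_assoc:
  assumes "is_mor F" "is_mor G" "is_mor H" "MSrc G = MTgt F" "MSrc H = MTgt G"
  shows "comp_mor (comp_mor H G) F = comp_mor H (comp_mor G F)"
proof -
  note [simp] = ty_psmor[OF assms(1)] ty_psmor[OF assms(2), unfolded assms(4)]
     ty_psmor[OF assms(3), unfolded assms(5)] assms(4,5)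
  have "((MArr H \<odot> Act (MTgt G)) \<lhd> inv2 (\<kappa> (MArr G) (MArr F))) \<bullet>
      (MCell H \<rhd> T\<^sub>1 (MArr G \<odot> MArr F)) =
     (MCell H \<rhd> (T\<^sub>1 (MArr G) \<odot> T\<^sub>1 (MArr F))) \<bullet>
      ((Act (MTgt H) \<odot> T\<^sub>1 (MArr H)) \<lhd> inv2 (\<kappa> (MArr G) (MArr F)))"
    by (rule whisker_exchange) simp_all
  then have "(MArr H \<lhd> Act (MTgt G) \<lhd> inv2 (\<kappa> (MArr G) (MArr F))) \<bullet>
      (MCell H \<rhd> T\<^sub>1 (MArr G \<odot> MArr F)) \<bullet> (Act (MTgt H) \<lhd> inv2 (\<kappa> (MArr H) (MArr G \<odot> MArr F))) =
     ((MCell H \<rhd> (T\<^sub>1 (MArr G) \<odot> T\<^sub>1 (MArr F))) \<bullet>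
      ((Act (MTgt H) \<odot> T\<^sub>1 (MArr H)) \<lhd> inv2 (\<kappa> (MArr G) (MArr F)))) \<bullet>
       (Act (MTgt H) \<lhd> inv2 (\<kappa> (MArr H) (MArr G \<odot> MArr F)))"
    by (intro VComp_extend) simp_all
  then show ?thesis
    by (intro psalg_mor.equality) (simp_all add: comp_mor_def T.Kap_Comp1_left)
qed

lemma is_cell_Id2: "is_mor F \<Longrightarrow> is_cell \<lparr>CDom = F, CCod = F, CCell = Id2 K (MArr F)\<rparr>"
  using ty_psmor[of F] by (auto simp: is_cell_def hom2_ty)

lemma is_cell_VComp:
  assumes "is_cell \<alpha>" "is_cell \<beta>" "CDom \<beta> = CCod \<alpha>"
  shows "is_cell \<lparr>CDom = CDom \<alpha>, CCod = CCod \<beta>, CCell = CCell \<beta> \<bullet> CCell \<alpha>\<rparr>"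
proof -
  note A = is_cellD[OF assms(1)] note B = is_cellD[OF assms(2), unfolded assms(3) A(3,4)]
  note [simp] = ty_psmor[OF A(1)] ty_psmor[OF A(2), unfolded A(3,4)]
    ty_psmor[OF B(2), unfolded B(3,4)] A(3-5) B(3-5)
  have "((CCell \<beta> \<bullet> CCell \<alpha>) \<rhd> Act (MSrc (CDom \<alpha>))) \<bullet> MCell (CDom \<alpha>) =
     (CCell \<beta> \<rhd> Act (MSrc (CDom \<alpha>))) \<bullet> (CCell \<alpha> \<rhd> Act (MSrc (CDom \<alpha>))) \<bullet> MCell (CDom \<alpha>)"
    by simp
  also have "\<dots> = ((CCell \<beta> \<rhd> Act (MSrc (CDom \<alpha>))) \<bullet> MCell (CCod \<alpha>)) \<bullet>
      (Act (MTgt (CDom \<alpha>)) \<lhd> T\<^sub>2 (CCell \<alpha>))"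
    unfolding A(6) by simp
  also have "\<dots> = MCell (CCod \<beta>) \<bullet> (Act (MTgt (CDom \<alpha>)) \<lhd> T\<^sub>2 (CCell \<beta> \<bullet> CCell \<alpha>))"
    unfolding B(6) by simp
  finally show ?thesis
    using A(1) B(2) by (simp add: is_cell_def hom2_ty)
qed

lemma is_cell_HComp:
  assumes "is_cell \<alpha>" "is_cell \<beta>" "MSrc (CDom \<beta>) = MTgt (CDom \<alpha>)"
  shows "is_cell \<lparr>CDom = comp_mor (CDom \<beta>) (CDom \<alpha>), CCod = comp_mor (CCod \<beta>) (CCod \<alpha>),
    CCell = CCell \<beta> \<star> CCell \<alpha>\<rparr>"
proof -
  note A = is_cellD[OF assms(1)] note B = is_cellD[OF assms(2), unfolded assms(3)]
  note [simp] = ty_psmor[OF A(1)] ty_psmor[OF A(2), unfolded A(3,4)]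
    ty_psmor[OF B(1), unfolded assms(3)] ty_psmor[OF B(2), unfolded B(3,4)] A(3-5) B(3-5) assms(3)
  let ?f = "MArr (CDom \<alpha>)" and ?f' = "MArr (CCod \<alpha>)" and ?g = "MArr (CDom \<beta>)" and ?g' = "MArr (CCod \<beta>)"
  let ?\<phi> = "MCell (CDom \<alpha>)" and ?\<phi>' = "MCell (CCod \<alpha>)" and ?\<chi> = "MCell (CDom \<beta>)" and ?\<chi>' = "MCell (CCod \<beta>)"
  let ?eA = "Act (MSrc (CDom \<alpha>))" and ?eB = "Act (MTgt (CDom \<alpha>))" and ?eC = "Act (MTgt (CDom \<beta>))"
  let ?a = "CCell \<alpha>" and ?b = "CCell \<beta>"
  \<comment> \<open>Typing and naturality rules exist in the simp set only for whiskerings, hence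
    \<star> is replaced throughout.\<close>
  have H: "?b \<star> ?a = (?b \<rhd> ?f') \<bullet> (?g \<lhd> ?a)"
    by (rule HComp_whisker[OF A(5) B(5) ty_psmor(1)[OF A(1)]]) simp
  have "((?b \<star> ?a) \<rhd> ?eA) \<bullet> (?g \<lhd> ?\<phi>) \<bullet> (?\<chi> \<rhd> T\<^sub>1 ?f) \<bullet> (?eC \<lhd> inv2 (\<kappa> ?g ?f)) =
    (?b \<rhd> ?f' \<rhd> ?eA) \<bullet> (?g \<lhd> ((?a \<rhd> ?eA) \<bullet> ?\<phi>)) \<bullet> (?\<chi> \<rhd> T\<^sub>1 ?f) \<bullet> (?eC \<lhd> inv2 (\<kappa> ?g ?f))"
    unfolding H by simp
  also have "\<dots> = (?b \<rhd> ?f' \<rhd> ?eA) \<bullet> (?g \<lhd> ?\<phi>') \<bullet> (((?g \<odot> ?eB) \<lhd> T\<^sub>2 ?a) \<bullet> (?\<chi> \<rhd> T\<^sub>1 ?f)) \<bullet>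
      (?eC \<lhd> inv2 (\<kappa> ?g ?f))"
    unfolding A(6) by simp
  also have "((?g \<odot> ?eB) \<lhd> T\<^sub>2 ?a) \<bullet> (?\<chi> \<rhd> T\<^sub>1 ?f) = (?\<chi> \<rhd> T\<^sub>1 ?f') \<bullet> ((?eC \<odot> T\<^sub>1 ?g) \<lhd> T\<^sub>2 ?a)"
    by (rule whisker_exchange) simp_all
  also have "(?b \<rhd> ?f' \<rhd> ?eA) \<bullet> (?g \<lhd> ?\<phi>') \<bullet> \<dots> \<bullet> (?eC \<lhd> inv2 (\<kappa> ?g ?f)) =
     ((?b \<rhd> (?f' \<odot> ?eA)) \<bullet> (?g \<lhd> ?\<phi>')) \<bullet> (?\<chi> \<rhd> T\<^sub>1 ?f') \<bullet> ((?eC \<odot> T\<^sub>1 ?g) \<lhd> T\<^sub>2 ?a) \<bullet> (?eC \<lhd> inv2 (\<kappa> ?g ?f))"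
    by simp
  also have "(?b \<rhd> (?f' \<odot> ?eA)) \<bullet> (?g \<lhd> ?\<phi>') = (?g' \<lhd> ?\<phi>') \<bullet> (?b \<rhd> (?eB \<odot> T\<^sub>1 ?f'))"
    by (rule whisker_exchange[symmetric]) simp_all
  also have "\<dots> \<bullet> (?\<chi> \<rhd> T\<^sub>1 ?f') \<bullet> ((?eC \<odot> T\<^sub>1 ?g) \<lhd> T\<^sub>2 ?a) \<bullet> (?eC \<lhd> inv2 (\<kappa> ?g ?f)) =
     (?g' \<lhd> ?\<phi>') \<bullet> (((?b \<rhd> ?eB) \<bullet> ?\<chi>) \<rhd> T\<^sub>1 ?f') \<bullet> ((?eC \<odot> T\<^sub>1 ?g) \<lhd> T\<^sub>2 ?a) \<bullet> (?eC \<lhd> inv2 (\<kappa> ?g ?f))"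
    by simp
  also have "\<dots> = ((?g' \<lhd> ?\<phi>') \<bullet> (?\<chi>' \<rhd> T\<^sub>1 ?f') \<bullet> (?eC \<lhd> inv2 (\<kappa> ?g' ?f'))) \<bullet> (?eC \<lhd> T\<^sub>2 (?b \<star> ?a))"
    unfolding H B(6) by (simp add: T.Map2_whisker)
  finally show ?thesis
    using A(1,2) B(1,2) by (simp add: is_cell_def hom2_ty is_mor_comp_mor H) (simp add: comp_mor_def flip: H)
qed

text \<open>A 2-cell of algebras is a 2-cell of K with its ends recorded, so the laws for 2-cells
  hold by the laws of K, applied to \<open>CCell\<close>; the ends agree by the laws of
  \<open>comp_mor\<close>.\<close>

lemma two_category_pseudoalgebras: "two_category pseudoalgebras"
proof -
  have assoc: "(CCell \<gamma> \<star> CCell \<beta>) \<star> CCell \<alpha> = CCell \<gamma> \<star> CCell \<beta> \<star> CCell \<alpha>"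
    if "MSrc (CDom \<beta>) = MTgt (CDom \<alpha>)" "MSrc (CDom \<gamma>) = MTgt (CDom \<beta>)"
      "is_cell \<alpha>" "is_cell \<beta>" "is_cell \<gamma>" for \<alpha> \<beta> \<gamma>
    using that ty_psmor(1)[OF is_cellD(1)] by (intro HComp_assoc'[OF _ _ _ is_cellD(5) is_cellD(5) is_cellD(5)]) auto
  have unit: "CCell \<alpha> \<star> Id2 K (Id1 K (Car (MSrc (CDom \<alpha>)))) = CCell \<alpha>"
    "Id2 K (Id1 K (Car (MTgt (CDom \<alpha>)))) \<star> CCell \<alpha> = CCell \<alpha>" if "is_cell \<alpha>" for \<alpha>
    using HComp_Id1_right HComp_Id1_left is_cellD(5)[OF that] ty_psmor(1)[OF is_cellD(1)[OF that]]
    by (auto simp: hom1_ty hom2_ty)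
  have ids: "Id2 K (MArr g) \<star> Id2 K (MArr f) = Id2 K (MArr g \<odot> MArr f)"
    if "is_mor f" "is_mor g" "MSrc g = MTgt f" for f g
    using that ty_psmor(1) by (intro HComp_Id2') auto
  have exch: "(CCell \<beta>' \<bullet> CCell \<beta>) \<star> (CCell \<alpha>' \<bullet> CCell \<alpha>) =
           (CCell \<beta>' \<star> CCell \<alpha>') \<bullet> (CCell \<beta> \<star> CCell \<alpha>)"
    if "MSrc (CDom \<beta>) = MTgt (CDom \<alpha>)" "is_cell \<alpha>" "is_cell \<beta>" "is_cell \<alpha>'"
        "CDom \<alpha>' = CCod \<alpha>" "is_cell \<beta>'" "CDom \<beta>' = CCod \<beta>" for \<alpha> \<alpha>' \<beta> \<beta>'
    using that ty_psmor(1)[OF is_cellD(1)] is_cellD(5)[of \<alpha>'] is_cellD(5)[of \<beta>']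
    by (intro interchange'[OF _ _ is_cellD(5) _ is_cellD(5)]) auto
  have right: "comp_mor (CCod \<alpha>) (id_mor (MSrc (CDom \<alpha>))) = CCod \<alpha>"
    "comp_mor (id_mor (MTgt (CDom \<alpha>))) (CCod \<alpha>) = CCod \<alpha>" if "is_cell \<alpha>" for \<alpha>
    using comp_mor_id_mor[OF is_cellD(2)[OF that]] is_cellD(3,4)[OF that] by auto
  have vert: "(CCell \<gamma> \<bullet> CCell \<beta>) \<bullet> CCell \<alpha> = CCell \<gamma> \<bullet> CCell \<beta> \<bullet> CCell \<alpha>"
    if "is_cell \<alpha>" "is_cell \<beta>" "CDom \<beta> = CCod \<alpha>" "is_cell \<gamma>" "CDom \<gamma> = CCod \<beta>" for \<alpha> \<beta> \<gamma>
    using that is_cellD(5)[of \<beta>] is_cellD(5)[of \<gamma>] by (intro VComp_assoc'[OF is_cellD(5)]) auto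
  have vunit: "Id2 K (MArr (CCod \<alpha>)) \<bullet> CCell \<alpha> = CCell \<alpha>"
    "CCell \<alpha> \<bullet> Id2 K (MArr (CDom \<alpha>)) = CCell \<alpha>" if "is_cell \<alpha>" for \<alpha>
    using is_cellD(5)[OF that] by auto
  show ?thesis
    by unfold_locales (auto simp: hom1_def hom2_def is_mor_id_mor is_mor_comp_mor is_cell_Id2
      is_cell_VComp is_cell_HComp comp_mor_id_mor comp_mor_assoc ty_psmor(4,5) is_cellD(1-4)
      vert vunit assoc unit ids exch right intro!: psalg_cell.equality)
qed

end

section \<open>Restriction along a pseudomorphism\<close>

sublocale pseudomonad_morphism \<subseteq> lam: pseudonatural K K M.T M'.T "Lam L"
  by (rule lam_pseudonatural)

context pseudomonad_morphism
begin

lemmas ty_u [simp] = invertible_modification.mod_ty[OF u_modification, simplified]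
lemmas ty_m [simp] = invertible_modification.mod_ty[OF m_modification, simplified]

section \<open>Sliding cells along u, m and \<lambda>\<close>

lemma u_nat:
  assumes "M.ty1 f = bd X Y"
  shows "(M'.T\<^sub>1 f \<lhd> u X) \<bullet> M'.\<eta>\<^sub>1 f =
    (lam\<^sub>1 f \<rhd> M.\<eta> X) \<bullet> (lam Y \<lhd> M.\<eta>\<^sub>1 f) \<bullet> (u Y \<rhd> f)"
proof -
  note [simp] = assms M.ty1D[OF assms]
  interpret u: invertible_modification K K "id_psf K" M'.T "Eta M'" "comp_pst K K (Lam L) (Eta M)" u
    by (rule u_modification)
  show ?thesis using u.mod_nat'[OF assms] by simp
qed

text \<open>The pseudonaturality cell at f of \<lambda> whiskered by T on the left, as it occurs in
  \<open>lamlam\<close>. The ends of f are arguments because the typing rules know them only through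
  \<open>ty1\<close>.\<close>

definition lam_hat :: "'m \<Rightarrow> 'o \<Rightarrow> 'o \<Rightarrow> 'c" where
  "lam_hat f X Y = inv2 (M.\<kappa> (M'.T\<^sub>1 f) (lam X)) \<bullet> M.T\<^sub>2 (lam\<^sub>1 f) \<bullet> M.\<kappa> (lam Y) (M.T\<^sub>1 f)"

lemma ty_lam_hat [simp]:
  assumes "M.ty1 f = bd X Y"
  shows "M.ty2 (lam_hat f X Y) =
    bd (M.T\<^sub>1 (lam Y) \<odot> M.T\<^sub>1 (M.T\<^sub>1 f)) (M.T\<^sub>1 (M'.T\<^sub>1 f) \<odot> M.T\<^sub>1 (lam X))"
  using assms M.ty1D(4,5)[OF assms] by (simp add: lam_hat_def)

text \<open>The modification axiom of m at f, with the structure cell of \<open>lamlam\<close>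
  unfolded into \<open>lam_hat\<close> followed by \<lambda> at the image of f under T'.\<close>

lemma m_nat:
  assumes "M.ty1 f = bd X Y"
  shows "(M'.T\<^sub>1 f \<lhd> m X) \<bullet> (M'.\<mu>\<^sub>1 f \<rhd> (lam (M'.T\<^sub>0 X) \<odot> M.T\<^sub>1 (lam X))) \<bullet>
    (M'.\<mu> Y \<lhd> lam\<^sub>1 (M'.T\<^sub>1 f) \<rhd> M.T\<^sub>1 (lam X)) \<bullet>
    ((M'.\<mu> Y \<odot> lam (M'.T\<^sub>0 Y)) \<lhd> lam_hat f X Y) =
    (lam\<^sub>1 f \<rhd> M.\<mu> X) \<bullet> (lam Y \<lhd> M.\<mu>\<^sub>1 f) \<bullet> (m Y \<rhd> M.T\<^sub>1 (M.T\<^sub>1 f))"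
proof -
  note [simp] = assms M.ty1D[OF assms]
  interpret m: invertible_modification K K M.TT M'.T "comp_pst K K (Mu M') lamlam"
    "comp_pst K K (Lam L) (Mu M)" m
    by (rule m_modification)
  have [simp]: "Src K (M'.T\<^sub>1 f) = M'.T\<^sub>0 X" "Tgt K (M'.T\<^sub>1 f) = M'.T\<^sub>0 Y"
    using M'.T.ty_Map(1)[OF assms] M.ty1D by auto
  show ?thesis using m.mod_nat'[OF assms] by (simp add: lam_hat_def)
qed

text \<open>Naturality of \<lambda> at \<theta>, with \<lambda> at the two composites split by
  \<open>lam.Str_Comp1\<close>. It converts a conjugated image under T' into one under T.\<close>

lemma lam_nat_square:
  assumes f: "M.ty1 f = bd X Y" and g: "M.ty1 g = bd Y Z" and f': "M.ty1 f' = bd X Y'"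
    and g': "M.ty1 g' = bd Y' Z" and \<theta>: "M.ty2 \<theta> = bd (g \<odot> f) (g' \<odot> f')"
  shows "((inv2 (M'.\<kappa> g' f') \<bullet> M'.T\<^sub>2 \<theta> \<bullet> M'.\<kappa> g f) \<rhd> lam X) \<bullet> (M'.T\<^sub>1 g \<lhd> lam\<^sub>1 f) \<bullet> (lam\<^sub>1 g \<rhd> M.T\<^sub>1 f) =
    (M'.T\<^sub>1 g' \<lhd> lam\<^sub>1 f') \<bullet> (lam\<^sub>1 g' \<rhd> M.T\<^sub>1 f') \<bullet> (lam Z \<lhd> (inv2 (M.\<kappa> g' f') \<bullet> M.T\<^sub>2 \<theta> \<bullet> M.\<kappa> g f))"
proof -
  note [simp] = assms M.ty1D(4,5)[OF f] M.ty1D(4,5)[OF g] M.ty1D(4,5)[OF f'] M.ty1D(4,5)[OF g']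
  have "(M'.T\<^sub>2 \<theta> \<rhd> lam X) \<bullet> lam\<^sub>1 (g \<odot> f) = lam\<^sub>1 (g' \<odot> f') \<bullet> (lam Z \<lhd> M.T\<^sub>2 \<theta>)"
    by (rule lam.Str_nat) simp_all
  then have "(inv2 (M'.\<kappa> g' f') \<rhd> lam X) \<bullet> ((M'.T\<^sub>2 \<theta> \<rhd> lam X) \<bullet> lam\<^sub>1 (g \<odot> f)) \<bullet> (lam Z \<lhd> M.\<kappa> g f) =
     (inv2 (M'.\<kappa> g' f') \<rhd> lam X) \<bullet> (lam\<^sub>1 (g' \<odot> f') \<bullet> (lam Z \<lhd> M.T\<^sub>2 \<theta>)) \<bullet> (lam Z \<lhd> M.\<kappa> g f)"
    by simp
  then show ?thesis by (simp add: lam.Str_Comp1)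
qed

text \<open>Separates the outer compositors, which will cancel against those inside the restricted
  \<gamma>, from the two inner cells that \<open>restricted_assoc\<close> speaks about.\<close>

lemma T_restricted:
  assumes f: "M.ty1 f = bd X Y" and eA: "M.ty1 eA = bd (M'.T\<^sub>0 X) X" and eB: "M.ty1 eB = bd (M'.T\<^sub>0 Y) Y"
    and \<phi>: "M.ty2 \<phi> = bd (eB \<odot> M'.T\<^sub>1 f) (f \<odot> eA)"
  shows "M.T\<^sub>2 ((\<phi> \<rhd> lam X) \<bullet> (eB \<lhd> lam\<^sub>1 f)) =
    M.\<kappa> f (eA \<odot> lam X) \<bullet> (M.T\<^sub>1 f \<lhd> M.\<kappa> eA (lam X)) \<bullet>
    ((inv2 (M.\<kappa> f eA) \<bullet> M.T\<^sub>2 \<phi> \<bullet> M.\<kappa> eB (M'.T\<^sub>1 f)) \<rhd> M.T\<^sub>1 (lam X)) \<bullet>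
    (M.T\<^sub>1 eB \<lhd> lam_hat f X Y) \<bullet>
    (inv2 (M.\<kappa> eB (lam Y)) \<rhd> M.T\<^sub>1 (M.T\<^sub>1 f)) \<bullet> inv2 (M.\<kappa> (eB \<odot> lam Y) (M.T\<^sub>1 f))"
proof -
  note [simp] = assms M.ty1D(4,5)[OF f]
  show ?thesis by (simp add: lam_hat_def M.T.Map2_whisker M.T.Kap_Comp1_left)
qed

text \<open>Read with \<open>f = e'\<close> and \<open>e\<^sub>A = \<mu>'\<close>, the associativity law of a pseudoalgebra is
  the associativity law of a morphism; hence this covers both restricted algebras and
  restricted morphisms.\<close>

lemma restricted_assoc:
  assumes f: "M.ty1 f = bd X Y" and eA: "M.ty1 eA = bd (M'.T\<^sub>0 X) X" and eB: "M.ty1 eB = bd (M'.T\<^sub>0 Y) Y"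
    and \<phi>: "M.ty2 \<phi> = bd (eB \<odot> M'.T\<^sub>1 f) (f \<odot> eA)"
    and gA: "M.ty2 gA = bd (eA \<odot> M'.T\<^sub>1 eA) (eA \<odot> M'.\<mu> X)"
    and gB: "M.ty2 gB = bd (eB \<odot> M'.T\<^sub>1 eB) (eB \<odot> M'.\<mu> Y)"
    and law: "(f \<lhd> gA) \<bullet> (\<phi> \<rhd> M'.T\<^sub>1 eA) \<bullet>
       (eB \<lhd> (inv2 (M'.\<kappa> f eA) \<bullet> M'.T\<^sub>2 \<phi> \<bullet> M'.\<kappa> eB (M'.T\<^sub>1 f))) =
       (\<phi> \<rhd> M'.\<mu> X) \<bullet> (eB \<lhd> M'.\<mu>\<^sub>1 f) \<bullet> (gB \<rhd> M'.T\<^sub>1 (M'.T\<^sub>1 f))"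
  defines "bf \<equiv> (\<phi> \<rhd> lam X) \<bullet> (eB \<lhd> lam\<^sub>1 f)"
  defines "bA \<equiv> (gA \<rhd> lam (M'.T\<^sub>0 X)) \<bullet> (eA \<lhd> lam\<^sub>1 eA)"
  defines "bB \<equiv> (gB \<rhd> lam (M'.T\<^sub>0 Y)) \<bullet> (eB \<lhd> lam\<^sub>1 eB)"
  shows "(bf \<rhd> M.\<mu> X) \<bullet> ((eB \<odot> lam Y) \<lhd> M.\<mu>\<^sub>1 f) \<bullet> (eB \<lhd> (m Y \<rhd> M.T\<^sub>1 (M.T\<^sub>1 f))) \<bullet>
      (bB \<rhd> (M.T\<^sub>1 (lam Y) \<odot> M.T\<^sub>1 (M.T\<^sub>1 f))) =
    ((f \<odot> eA) \<lhd> m X) \<bullet> (f \<lhd> bA \<rhd> M.T\<^sub>1 (lam X)) \<bullet> (bf \<rhd> (M.T\<^sub>1 eA \<odot> M.T\<^sub>1 (lam X))) \<bullet>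
    ((eB \<odot> lam Y) \<lhd> (inv2 (M.\<kappa> f eA) \<bullet> M.T\<^sub>2 \<phi> \<bullet> M.\<kappa> eB (M'.T\<^sub>1 f)) \<rhd> M.T\<^sub>1 (lam X)) \<bullet>
    ((eB \<odot> lam Y \<odot> M.T\<^sub>1 eB) \<lhd> lam_hat f X Y)"
    (is "?lhs = ?rhs")
proof -
  note [simp] = f eA eB \<phi> gA gB M.ty1D(4,5)[OF f]
  \<comment> \<open>The law for \<phi> involves its image under T', the restricted law its image
    under T; \<open>lam_nat_square\<close> is the passage between the two.\<close>
  define G' where "G' = inv2 (M'.\<kappa> f eA) \<bullet> M'.T\<^sub>2 \<phi> \<bullet> M'.\<kappa> eB (M'.T\<^sub>1 f)"
  define G where "G = inv2 (M.\<kappa> f eA) \<bullet> M.T\<^sub>2 \<phi> \<bullet> M.\<kappa> eB (M'.T\<^sub>1 f)"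
  have [simp]: "M.ty2 G' = bd (M'.T\<^sub>1 eB \<odot> M'.T\<^sub>1 (M'.T\<^sub>1 f)) (M'.T\<^sub>1 f \<odot> M'.T\<^sub>1 eA)"
    "M.ty2 G = bd (M.T\<^sub>1 eB \<odot> M.T\<^sub>1 (M'.T\<^sub>1 f)) (M.T\<^sub>1 f \<odot> M.T\<^sub>1 eA)"
    by (simp_all add: G_def G'_def)
  have [simp]: "M.ty2 bf = bd (eB \<odot> lam Y \<odot> M.T\<^sub>1 f) (f \<odot> eA \<odot> lam X)"
    "M.ty2 bA = bd (eA \<odot> lam X \<odot> M.T\<^sub>1 eA) (eA \<odot> M'.\<mu> X \<odot> lam (M'.T\<^sub>0 X))"
    "M.ty2 bB = bd (eB \<odot> lam Y \<odot> M.T\<^sub>1 eB) (eB \<odot> M'.\<mu> Y \<odot> lam (M'.T\<^sub>0 Y))"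
    by (simp_all add: bf_def bA_def bB_def)
  let ?SX = "M'.T\<^sub>0 X" and ?SY = "M'.T\<^sub>0 Y"
  have "?lhs = (\<phi> \<rhd> (lam X \<odot> M.\<mu> X)) \<bullet>
      (eB \<lhd> ((lam\<^sub>1 f \<rhd> M.\<mu> X) \<bullet> (lam Y \<lhd> M.\<mu>\<^sub>1 f) \<bullet> (m Y \<rhd> M.T\<^sub>1 (M.T\<^sub>1 f)))) \<bullet>
      (bB \<rhd> (M.T\<^sub>1 (lam Y) \<odot> M.T\<^sub>1 (M.T\<^sub>1 f)))"
    by (simp add: bf_def)
  \<comment> \<open>m is moved from Y to X, which replaces \<mu> by \<mu>' and creates the two cells
    of \<open>lamlam\<close> at f.\<close>
  also have "\<dots> = ((\<phi> \<rhd> (lam X \<odot> M.\<mu> X)) \<bullet> ((eB \<odot> M'.T\<^sub>1 f) \<lhd> m X)) \<bullet>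
      (eB \<lhd> (M'.\<mu>\<^sub>1 f \<rhd> (lam ?SX \<odot> M.T\<^sub>1 (lam X)))) \<bullet>
      (eB \<lhd> M'.\<mu> Y \<lhd> lam\<^sub>1 (M'.T\<^sub>1 f) \<rhd> M.T\<^sub>1 (lam X)) \<bullet>
      ((eB \<odot> M'.\<mu> Y \<odot> lam ?SY) \<lhd> lam_hat f X Y) \<bullet>
      (bB \<rhd> (M.T\<^sub>1 (lam Y) \<odot> M.T\<^sub>1 (M.T\<^sub>1 f)))"
    by (subst m_nat[OF f, symmetric]) simp
  also have "(\<phi> \<rhd> (lam X \<odot> M.\<mu> X)) \<bullet> ((eB \<odot> M'.T\<^sub>1 f) \<lhd> m X) =
      ((f \<odot> eA) \<lhd> m X) \<bullet> (\<phi> \<rhd> (M'.\<mu> X \<odot> lam ?SX \<odot> M.T\<^sub>1 (lam X)))"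
    by (rule M.whisker_exchange[symmetric]) simp_all
  also have "((eB \<odot> M'.\<mu> Y \<odot> lam ?SY) \<lhd> lam_hat f X Y) \<bullet> (bB \<rhd> (M.T\<^sub>1 (lam Y) \<odot> M.T\<^sub>1 (M.T\<^sub>1 f))) =
      (bB \<rhd> (M.T\<^sub>1 (M'.T\<^sub>1 f) \<odot> M.T\<^sub>1 (lam X))) \<bullet> ((eB \<odot> lam Y \<odot> M.T\<^sub>1 eB) \<lhd> lam_hat f X Y)"
    by (rule M.whisker_exchange) simp_all
  also have "(((f \<odot> eA) \<lhd> m X) \<bullet> (\<phi> \<rhd> (M'.\<mu> X \<odot> lam ?SX \<odot> M.T\<^sub>1 (lam X)))) \<bullet>
      (eB \<lhd> (M'.\<mu>\<^sub>1 f \<rhd> (lam ?SX \<odot> M.T\<^sub>1 (lam X)))) \<bullet>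
      (eB \<lhd> M'.\<mu> Y \<lhd> lam\<^sub>1 (M'.T\<^sub>1 f) \<rhd> M.T\<^sub>1 (lam X)) \<bullet> \<dots> =
    ((f \<odot> eA) \<lhd> m X) \<bullet> (\<phi> \<rhd> (M'.\<mu> X \<odot> lam ?SX \<odot> M.T\<^sub>1 (lam X))) \<bullet>
      (eB \<lhd> (M'.\<mu>\<^sub>1 f \<rhd> (lam ?SX \<odot> M.T\<^sub>1 (lam X)))) \<bullet>
      ((((eB \<odot> M'.\<mu> Y) \<lhd> lam\<^sub>1 (M'.T\<^sub>1 f)) \<bullet> (gB \<rhd> (lam ?SY \<odot> M.T\<^sub>1 (M'.T\<^sub>1 f)))) \<rhd> M.T\<^sub>1 (lam X)) \<bullet>
      (eB \<lhd> (lam\<^sub>1 eB \<rhd> (M.T\<^sub>1 (M'.T\<^sub>1 f) \<odot> M.T\<^sub>1 (lam X)))) \<bullet>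
      ((eB \<odot> lam Y \<odot> M.T\<^sub>1 eB) \<lhd> lam_hat f X Y)"
    by (simp add: bB_def)
  also have "((eB \<odot> M'.\<mu> Y) \<lhd> lam\<^sub>1 (M'.T\<^sub>1 f)) \<bullet> (gB \<rhd> (lam ?SY \<odot> M.T\<^sub>1 (M'.T\<^sub>1 f))) =
     (gB \<rhd> (M'.T\<^sub>1 (M'.T\<^sub>1 f) \<odot> lam ?SX)) \<bullet> ((eB \<odot> M'.T\<^sub>1 eB) \<lhd> lam\<^sub>1 (M'.T\<^sub>1 f))"
    by (rule M.whisker_exchange) simp_all
  also have "((f \<odot> eA) \<lhd> m X) \<bullet> (\<phi> \<rhd> (M'.\<mu> X \<odot> lam ?SX \<odot> M.T\<^sub>1 (lam X))) \<bullet>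
      (eB \<lhd> (M'.\<mu>\<^sub>1 f \<rhd> (lam ?SX \<odot> M.T\<^sub>1 (lam X)))) \<bullet> (\<dots> \<rhd> M.T\<^sub>1 (lam X)) \<bullet>
      (eB \<lhd> (lam\<^sub>1 eB \<rhd> (M.T\<^sub>1 (M'.T\<^sub>1 f) \<odot> M.T\<^sub>1 (lam X)))) \<bullet>
      ((eB \<odot> lam Y \<odot> M.T\<^sub>1 eB) \<lhd> lam_hat f X Y) =
    ((f \<odot> eA) \<lhd> m X) \<bullet> (((\<phi> \<rhd> M'.\<mu> X) \<bullet> (eB \<lhd> M'.\<mu>\<^sub>1 f) \<bullet> (gB \<rhd> M'.T\<^sub>1 (M'.T\<^sub>1 f))) \<rhd> (lam ?SX \<odot> M.T\<^sub>1 (lam X))) \<bullet>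
      (((eB \<odot> M'.T\<^sub>1 eB) \<lhd> lam\<^sub>1 (M'.T\<^sub>1 f)) \<rhd> M.T\<^sub>1 (lam X)) \<bullet>
      (eB \<lhd> (lam\<^sub>1 eB \<rhd> (M.T\<^sub>1 (M'.T\<^sub>1 f) \<odot> M.T\<^sub>1 (lam X)))) \<bullet>
      ((eB \<odot> lam Y \<odot> M.T\<^sub>1 eB) \<lhd> lam_hat f X Y)"
    by simp
  \<comment> \<open>The preceding exchanges have assembled exactly the right-hand side of
    \<open>law\<close> as one whiskered block.\<close>
  also have "\<dots> = ((f \<odot> eA) \<lhd> m X) \<bullet> (f \<lhd> (gA \<rhd> (lam ?SX \<odot> M.T\<^sub>1 (lam X)))) \<bullet>
      (\<phi> \<rhd> (M'.T\<^sub>1 eA \<odot> lam ?SX \<odot> M.T\<^sub>1 (lam X))) \<bullet>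
      (eB \<lhd> (((G' \<rhd> lam ?SX) \<bullet> (M'.T\<^sub>1 eB \<lhd> lam\<^sub>1 (M'.T\<^sub>1 f)) \<bullet>
      (lam\<^sub>1 eB \<rhd> M.T\<^sub>1 (M'.T\<^sub>1 f))) \<rhd> M.T\<^sub>1 (lam X))) \<bullet>
      ((eB \<odot> lam Y \<odot> M.T\<^sub>1 eB) \<lhd> lam_hat f X Y)"
    unfolding law[symmetric, folded G'_def] by simp
  also have "(G' \<rhd> lam ?SX) \<bullet> (M'.T\<^sub>1 eB \<lhd> lam\<^sub>1 (M'.T\<^sub>1 f)) \<bullet> (lam\<^sub>1 eB \<rhd> M.T\<^sub>1 (M'.T\<^sub>1 f)) =
      (M'.T\<^sub>1 f \<lhd> lam\<^sub>1 eA) \<bullet> (lam\<^sub>1 f \<rhd> M.T\<^sub>1 eA) \<bullet> (lam Y \<lhd> G)"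
    unfolding G_def G'_def by (rule lam_nat_square) simp_all
  also have "((f \<odot> eA) \<lhd> m X) \<bullet> (f \<lhd> (gA \<rhd> (lam ?SX \<odot> M.T\<^sub>1 (lam X)))) \<bullet>
      (\<phi> \<rhd> (M'.T\<^sub>1 eA \<odot> lam ?SX \<odot> M.T\<^sub>1 (lam X))) \<bullet> (eB \<lhd> (\<dots> \<rhd> M.T\<^sub>1 (lam X))) \<bullet>
      ((eB \<odot> lam Y \<odot> M.T\<^sub>1 eB) \<lhd> lam_hat f X Y) =
    ((f \<odot> eA) \<lhd> m X) \<bullet> (f \<lhd> (gA \<rhd> (lam ?SX \<odot> M.T\<^sub>1 (lam X)))) \<bullet>
      (((\<phi> \<rhd> (M'.T\<^sub>1 eA \<odot> lam ?SX)) \<bullet> ((eB \<odot> M'.T\<^sub>1 f) \<lhd> lam\<^sub>1 eA)) \<rhd> M.T\<^sub>1 (lam X)) \<bullet>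
      (eB \<lhd> (((lam\<^sub>1 f \<rhd> M.T\<^sub>1 eA) \<bullet> (lam Y \<lhd> G)) \<rhd> M.T\<^sub>1 (lam X))) \<bullet>
      ((eB \<odot> lam Y \<odot> M.T\<^sub>1 eB) \<lhd> lam_hat f X Y)"
    by simp
  also have "(\<phi> \<rhd> (M'.T\<^sub>1 eA \<odot> lam ?SX)) \<bullet> ((eB \<odot> M'.T\<^sub>1 f) \<lhd> lam\<^sub>1 eA) =
      ((f \<odot> eA) \<lhd> lam\<^sub>1 eA) \<bullet> (\<phi> \<rhd> (lam X \<odot> M.T\<^sub>1 eA))"
    by (rule M.whisker_exchange[symmetric]) simp_all
  also have "((f \<odot> eA) \<lhd> m X) \<bullet> (f \<lhd> (gA \<rhd> (lam ?SX \<odot> M.T\<^sub>1 (lam X)))) \<bullet>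
      (\<dots> \<rhd> M.T\<^sub>1 (lam X)) \<bullet>
      (eB \<lhd> (((lam\<^sub>1 f \<rhd> M.T\<^sub>1 eA) \<bullet> (lam Y \<lhd> G)) \<rhd> M.T\<^sub>1 (lam X))) \<bullet>
      ((eB \<odot> lam Y \<odot> M.T\<^sub>1 eB) \<lhd> lam_hat f X Y) = ?rhs"
    unfolding G_def[symmetric] by (simp add: bf_def bA_def)
  finally show ?thesis .
qed

end

section \<open>Restricted algebras\<close>

lemma restrict_alg_sel [simp]:
  "Car (pseudomonad_morphism_data.restrict_alg K M M' L A) = Car A"
  "Act (pseudomonad_morphism_data.restrict_alg K M M' L A) = Act A \<odot>\<^bsub>K\<^esub> Cmp (Lam L) (Car A)"
  "Iota (pseudomonad_morphism_data.restrict_alg K M M' L A) =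
     Iota A \<bullet>\<^bsub>K\<^esub> (Act A \<lhd>\<^bsub>K\<^esub> inv2\<^bsub>K\<^esub> (Umod L (Car A)))"
  by (simp_all add: pseudomonad_morphism_data.restrict_alg_def Let_def)

context pseudomonad_morphism
begin

text \<open>Groups the cells \<gamma>' and \<lambda> at e' into one whiskered block, which later
  proofs name and exchange as a single 2-cell.\<close>

lemma restrict_alg_Gam:
  assumes "pseudoalgebra K M' A"
  shows "Gam (restrict_alg A) = (Act A \<lhd> m (Car A)) \<bullet>
     (((Gam A \<rhd> lam (M'.T\<^sub>0 (Car A))) \<bullet> (Act A \<lhd> lam\<^sub>1 (Act A))) \<rhd> M.T\<^sub>1 (lam (Car A))) \<bullet>
     ((Act A \<odot> lam (Car A)) \<lhd> inv2 (M.\<kappa> (Act A) (lam (Car A))))"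
proof -
  interpret pseudoalgebra K M' A by fact
  show ?thesis by (simp add: restrict_alg_def Let_def)
qed

text \<open>The right unit law of (\<lambda>, u, m) replaces r by r' at the cost of \<open>W\<close>
  and the inverse of \<lambda> at \<eta>'. The unit law of the T'-algebra then turns r' into
  \<gamma>', and both extra cells cancel after an exchange.\<close>

lemma restrict_alg_unit:
  assumes "pseudoalgebra K M' A"
  shows "Gam (restrict_alg A) \<rhd> M.T\<^sub>1 (M.\<eta> (Car A)) =
       ((Act A \<odot> lam (Car A)) \<lhd> M.run (Car A)) \<bullet>
       ((Act A \<odot> lam (Car A)) \<lhd> (inv2 (M.\<upsilon> (Car A)) \<bullet> M.T\<^sub>2 (Iota A \<bullet> (Act A \<lhd> inv2 (u (Car A)))) \<bullet>
         M.\<kappa> (Act A \<odot> lam (Car A)) (M.\<eta> (Car A))))" (is "?lhs = ?rhs")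
proof -
  interpret A: pseudoalgebra K M' A by fact
  let ?X = "Car A" and ?e = "Act A" and ?i = "Iota A" and ?g = "Gam A"
  let ?SX = "M'.T\<^sub>0 ?X"
  define b where "b = (?g \<rhd> lam ?SX) \<bullet> (?e \<lhd> lam\<^sub>1 ?e)"
  define W where "W = inv2 (M.\<kappa> (lam ?X) (M.\<eta> ?X)) \<bullet> M.T\<^sub>2 (u ?X)"
  define I where "I = inv2 (M.\<upsilon> ?X) \<bullet> M.T\<^sub>2 ?i \<bullet> M.\<kappa> ?e (M'.\<eta> ?X)"
  define I' where "I' = inv2 (M'.\<upsilon> ?X) \<bullet> M'.T\<^sub>2 ?i \<bullet> M'.\<kappa> ?e (M'.\<eta> ?X)"
  have [simp]: "M.ty2 b = bd (?e \<odot> lam ?X \<odot> M.T\<^sub>1 ?e) (?e \<odot> M'.\<mu> ?X \<odot> lam ?SX)"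
    by (simp add: b_def)
  have [simp]: "M.ty2 W = bd (M.T\<^sub>1 (M'.\<eta> ?X)) (M.T\<^sub>1 (lam ?X) \<odot> M.T\<^sub>1 (M.\<eta> ?X))" "M.invertible W"
    by (simp_all add: W_def)
  have [simp]: "M.ty2 I = bd (M.T\<^sub>1 ?e \<odot> M.T\<^sub>1 (M'.\<eta> ?X)) (Id1 K (M.T\<^sub>0 ?X))"
    "M.ty2 I' = bd (M'.T\<^sub>1 ?e \<odot> M'.T\<^sub>1 (M'.\<eta> ?X)) (Id1 K (M'.T\<^sub>0 ?X))"
    by (simp_all add: I_def I'_def)
  \<comment> \<open>The analogue of \<open>lam_nat_square\<close> for a 2-cell into an identity:
    unitors take the place of the compositors at the target.\<close>
  have I: "lam ?X \<lhd> I = (I' \<rhd> lam ?X) \<bullet> (M'.T\<^sub>1 ?e \<lhd> lam\<^sub>1 (M'.\<eta> ?X)) \<bullet> (lam\<^sub>1 ?e \<rhd> M.T\<^sub>1 (M'.\<eta> ?X))"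
  proof -
    have "(M'.T\<^sub>2 ?i \<rhd> lam ?X) \<bullet> lam\<^sub>1 (?e \<odot> M'.\<eta> ?X) = lam\<^sub>1 (Id1 K ?X) \<bullet> (lam ?X \<lhd> M.T\<^sub>2 ?i)"
      by (rule lam.Str_nat) simp_all
    then have "(inv2 (M'.\<upsilon> ?X) \<rhd> lam ?X) \<bullet> ((M'.T\<^sub>2 ?i \<rhd> lam ?X) \<bullet> lam\<^sub>1 (?e \<odot> M'.\<eta> ?X)) \<bullet>
        (lam ?X \<lhd> M.\<kappa> ?e (M'.\<eta> ?X)) =
      (inv2 (M'.\<upsilon> ?X) \<rhd> lam ?X) \<bullet> (lam\<^sub>1 (Id1 K ?X) \<bullet> (lam ?X \<lhd> M.T\<^sub>2 ?i)) \<bullet> (lam ?X \<lhd> M.\<kappa> ?e (M'.\<eta> ?X))"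
      by simp
    then show ?thesis by (simp add: lam.Str_Comp1 lam.Str_Id1 I_def I'_def)
  qed
  have "?rhs = (?e \<lhd> (lam ?X \<lhd> M.run ?X)) \<bullet> (?e \<lhd> (lam ?X \<lhd> I)) \<bullet>
      ((?e \<odot> lam ?X \<odot> M.T\<^sub>1 ?e) \<lhd> inv2 W) \<bullet>
      (?e \<lhd> lam ?X \<lhd> inv2 (M.\<kappa> ?e (lam ?X)) \<rhd> M.T\<^sub>1 (M.\<eta> ?X))"
    by (simp add: I_def W_def M.T.Map2_whisker M.T.Kap_Comp1_left)
  also have "lam ?X \<lhd> M.run ?X = (m ?X \<rhd> M.T\<^sub>1 (M.\<eta> ?X)) \<bullet>
      (M'.\<mu> ?X \<lhd> ((lam ?SX \<lhd> W) \<bullet> inv2 (lam\<^sub>1 (M'.\<eta> ?X)))) \<bullet> (M'.run ?X \<rhd> lam ?X)"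
    unfolding W_def by (rule right_unit_law) simp
  also have "(?e \<lhd> \<dots>) \<bullet> (?e \<lhd> (lam ?X \<lhd> I)) \<bullet>
      ((?e \<odot> lam ?X \<odot> M.T\<^sub>1 ?e) \<lhd> inv2 W) \<bullet>
      (?e \<lhd> lam ?X \<lhd> inv2 (M.\<kappa> ?e (lam ?X)) \<rhd> M.T\<^sub>1 (M.\<eta> ?X)) =
    (?e \<lhd> m ?X \<rhd> M.T\<^sub>1 (M.\<eta> ?X)) \<bullet> ((?e \<odot> M'.\<mu> ?X \<odot> lam ?SX) \<lhd> W) \<bullet>
      (?e \<lhd> M'.\<mu> ?X \<lhd> inv2 (lam\<^sub>1 (M'.\<eta> ?X))) \<bullet> (((?e \<lhd> M'.run ?X) \<bullet> (?e \<lhd> I')) \<rhd> lam ?X) \<bullet>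
      (?e \<lhd> M'.T\<^sub>1 ?e \<lhd> lam\<^sub>1 (M'.\<eta> ?X)) \<bullet> (?e \<lhd> lam\<^sub>1 ?e \<rhd> M.T\<^sub>1 (M'.\<eta> ?X)) \<bullet>
      ((?e \<odot> lam ?X \<odot> M.T\<^sub>1 ?e) \<lhd> inv2 W) \<bullet>
      (?e \<lhd> lam ?X \<lhd> inv2 (M.\<kappa> ?e (lam ?X)) \<rhd> M.T\<^sub>1 (M.\<eta> ?X))"
    unfolding I by simp
  also have "\<dots> = (?e \<lhd> m ?X \<rhd> M.T\<^sub>1 (M.\<eta> ?X)) \<bullet> ((?e \<odot> M'.\<mu> ?X \<odot> lam ?SX) \<lhd> W) \<bullet>
      (?e \<lhd> M'.\<mu> ?X \<lhd> inv2 (lam\<^sub>1 (M'.\<eta> ?X))) \<bullet> ((?g \<rhd> (M'.T\<^sub>1 (M'.\<eta> ?X) \<odot> lam ?X)) \<bullet>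
      ((?e \<odot> M'.T\<^sub>1 ?e) \<lhd> lam\<^sub>1 (M'.\<eta> ?X))) \<bullet> (?e \<lhd> lam\<^sub>1 ?e \<rhd> M.T\<^sub>1 (M'.\<eta> ?X)) \<bullet>
      ((?e \<odot> lam ?X \<odot> M.T\<^sub>1 ?e) \<lhd> inv2 W) \<bullet>
      (?e \<lhd> lam ?X \<lhd> inv2 (M.\<kappa> ?e (lam ?X)) \<rhd> M.T\<^sub>1 (M.\<eta> ?X))"
    unfolding I'_def A.alg_unit_law[symmetric] by simp
  \<comment> \<open>Brings \<lambda> at \<eta>' next to its inverse from the right unit law; the
    following exchange does the same for \<open>W\<close>.\<close>
  also have "(?g \<rhd> (M'.T\<^sub>1 (M'.\<eta> ?X) \<odot> lam ?X)) \<bullet> ((?e \<odot> M'.T\<^sub>1 ?e) \<lhd> lam\<^sub>1 (M'.\<eta> ?X)) =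
      ((?e \<odot> M'.\<mu> ?X) \<lhd> lam\<^sub>1 (M'.\<eta> ?X)) \<bullet> (?g \<rhd> (lam ?SX \<odot> M.T\<^sub>1 (M'.\<eta> ?X)))"
    by (rule M.whisker_exchange[symmetric]) simp_all
  also have "(?e \<lhd> m ?X \<rhd> M.T\<^sub>1 (M.\<eta> ?X)) \<bullet> ((?e \<odot> M'.\<mu> ?X \<odot> lam ?SX) \<lhd> W) \<bullet>
      (?e \<lhd> M'.\<mu> ?X \<lhd> inv2 (lam\<^sub>1 (M'.\<eta> ?X))) \<bullet> \<dots> \<bullet> (?e \<lhd> lam\<^sub>1 ?e \<rhd> M.T\<^sub>1 (M'.\<eta> ?X)) \<bullet>
      ((?e \<odot> lam ?X \<odot> M.T\<^sub>1 ?e) \<lhd> inv2 W) \<bullet>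
      (?e \<lhd> lam ?X \<lhd> inv2 (M.\<kappa> ?e (lam ?X)) \<rhd> M.T\<^sub>1 (M.\<eta> ?X)) =
    (?e \<lhd> m ?X \<rhd> M.T\<^sub>1 (M.\<eta> ?X)) \<bullet> (((?e \<odot> M'.\<mu> ?X \<odot> lam ?SX) \<lhd> W) \<bullet> (b \<rhd> M.T\<^sub>1 (M'.\<eta> ?X))) \<bullet>
      ((?e \<odot> lam ?X \<odot> M.T\<^sub>1 ?e) \<lhd> inv2 W) \<bullet>
      (?e \<lhd> lam ?X \<lhd> inv2 (M.\<kappa> ?e (lam ?X)) \<rhd> M.T\<^sub>1 (M.\<eta> ?X))"
    by (simp add: b_def)
  also have "((?e \<odot> M'.\<mu> ?X \<odot> lam ?SX) \<lhd> W) \<bullet> (b \<rhd> M.T\<^sub>1 (M'.\<eta> ?X)) =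
      (b \<rhd> (M.T\<^sub>1 (lam ?X) \<odot> M.T\<^sub>1 (M.\<eta> ?X))) \<bullet> ((?e \<odot> lam ?X \<odot> M.T\<^sub>1 ?e) \<lhd> W)"
    by (rule M.whisker_exchange) simp_all
  also have "(?e \<lhd> m ?X \<rhd> M.T\<^sub>1 (M.\<eta> ?X)) \<bullet> \<dots> \<bullet> ((?e \<odot> lam ?X \<odot> M.T\<^sub>1 ?e) \<lhd> inv2 W) \<bullet>
      (?e \<lhd> lam ?X \<lhd> inv2 (M.\<kappa> ?e (lam ?X)) \<rhd> M.T\<^sub>1 (M.\<eta> ?X)) = ?lhs"
    unfolding restrict_alg_Gam[OF assms, folded b_def] by simp
  finally show ?thesis by simp
qed

lemma restrict_alg_assoc:
  assumes "pseudoalgebra K M' A"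
  shows "((Act A \<odot> lam (Car A)) \<lhd> M.asc (Car A)) \<bullet>
       (Gam (restrict_alg A) \<rhd> M.T\<^sub>1 (M.\<mu> (Car A))) \<bullet>
       ((Act A \<odot> lam (Car A)) \<lhd> (inv2 (M.\<kappa> (Act A \<odot> lam (Car A)) (M.\<mu> (Car A))) \<bullet>
         M.T\<^sub>2 (Gam (restrict_alg A)) \<bullet> M.\<kappa> (Act A \<odot> lam (Car A)) (M.T\<^sub>1 (Act A \<odot> lam (Car A))))) =
       (Gam (restrict_alg A) \<rhd> M.\<mu> (M.T\<^sub>0 (Car A))) \<bullet>
       ((Act A \<odot> lam (Car A)) \<lhd> M.\<mu>\<^sub>1 (Act A \<odot> lam (Car A))) \<bullet>
       (Gam (restrict_alg A) \<rhd> M.T\<^sub>1 (M.T\<^sub>1 (Act A \<odot> lam (Car A))))" (is "?lhs = ?rhs")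
proof -
  interpret A: pseudoalgebra K M' A by fact
  let ?X = "Car A" and ?e = "Act A" and ?g = "Gam A"
  let ?SX = "M'.T\<^sub>0 ?X"
  let ?l = "lam ?X" and ?lS = "lam ?SX"
  let ?Tl = "M.T\<^sub>1 ?l" and ?TTl = "M.T\<^sub>1 (M.T\<^sub>1 ?l)" and ?TlS = "M.T\<^sub>1 ?lS"
  let ?Te = "M.T\<^sub>1 ?e" and ?TTe = "M.T\<^sub>1 (M.T\<^sub>1 ?e)"
  define \<Gamma> where "\<Gamma> = Gam (restrict_alg A)"
  define b where "b = (?g \<rhd> ?lS) \<bullet> (?e \<lhd> lam\<^sub>1 ?e)"
  \<comment> \<open>The same block as \<open>b\<close>, but for the free algebra with action \<mu>'
    and associator a'.\<close>
  define c where "c = (M'.asc ?X \<rhd> lam (M'.T\<^sub>0 ?SX)) \<bullet> (M'.\<mu> ?X \<lhd> lam\<^sub>1 (M'.\<mu> ?X))"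
  define k where "k = M.T\<^sub>2 (M.\<kappa> ?e ?l) \<bullet> M.\<kappa> ?Te ?Tl"
  define G where "G = inv2 (M.\<kappa> ?e (M'.\<mu> ?X)) \<bullet> M.T\<^sub>2 ?g \<bullet> M.\<kappa> ?e (M'.T\<^sub>1 ?e)"
  define H where "H = lam_hat ?e ?SX ?X"
  define Q where "Q = inv2 (M.\<kappa> ?l (M.\<mu> ?X)) \<bullet> M.T\<^sub>2 (m ?X) \<bullet> M.\<kappa> (M'.\<mu> ?X) (?lS \<odot> ?Tl) \<bullet>
    (M.T\<^sub>1 (M'.\<mu> ?X) \<lhd> M.\<kappa> ?lS ?Tl)"
  have [simp]: "M.ty2 b = bd (?e \<odot> ?l \<odot> ?Te) (?e \<odot> M'.\<mu> ?X \<odot> ?lS)"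
    by (simp add: b_def)
  have [simp]: "M.ty2 c = bd (M'.\<mu> ?X \<odot> ?lS \<odot> M.T\<^sub>1 (M'.\<mu> ?X)) (M'.\<mu> ?X \<odot> M'.\<mu> ?SX \<odot> lam (M'.T\<^sub>0 ?SX))"
    by (simp add: c_def)
  have [simp]: "M.ty2 k = bd (?TTe \<odot> ?TTl) (M.T\<^sub>1 (M.T\<^sub>1 (?e \<odot> ?l)))" "M.invertible k"
    by (simp_all add: k_def)
  have [simp]: "M.ty2 G = bd (?Te \<odot> M.T\<^sub>1 (M'.T\<^sub>1 ?e)) (?Te \<odot> M.T\<^sub>1 (M'.\<mu> ?X))"
    by (simp add: G_def)
  have [simp]: "M.ty2 H = bd (?Tl \<odot> ?TTe) (M.T\<^sub>1 (M'.T\<^sub>1 ?e) \<odot> ?TlS)"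
    by (simp add: H_def)
  have [simp]: "M.ty2 Q = bd (M.T\<^sub>1 (M'.\<mu> ?X) \<odot> ?TlS \<odot> ?TTl) (?Tl \<odot> M.T\<^sub>1 (M.\<mu> ?X))"
    by (simp add: Q_def)
  have \<Gamma>: "\<Gamma> = (?e \<lhd> m ?X) \<bullet> (b \<rhd> ?Tl) \<bullet> ((?e \<odot> ?l) \<lhd> inv2 (M.\<kappa> ?e ?l))"
    unfolding \<Gamma>_def b_def by (rule restrict_alg_Gam) fact
  have [simp]: "M.ty2 \<Gamma> = bd (?e \<odot> ?l \<odot> M.T\<^sub>1 (?e \<odot> ?l)) (?e \<odot> ?l \<odot> M.\<mu> ?X)"
    by (simp add: \<Gamma>)
  have Tb: "M.T\<^sub>2 b = M.\<kappa> ?e (M'.\<mu> ?X \<odot> ?lS) \<bullet> (?Te \<lhd> M.\<kappa> (M'.\<mu> ?X) ?lS) \<bullet> (G \<rhd> ?TlS) \<bullet> (?Te \<lhd> H) \<bullet>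
      (inv2 (M.\<kappa> ?e ?l) \<rhd> ?TTe) \<bullet> inv2 (M.\<kappa> (?e \<odot> ?l) ?Te)"
    unfolding b_def G_def H_def by (rule T_restricted) simp_all
  \<comment> \<open>The conjugated image of the restricted \<gamma>, precomposed with enough
    compositors that only \<open>Q\<close>, \<open>G\<close>, \<open>H\<close> and one leading
    compositor remain; the latter cancels inside \<open>\<Gamma>\<close>.\<close>
  have T\<Gamma>: "(inv2 (M.\<kappa> (?e \<odot> ?l) (M.\<mu> ?X)) \<bullet> M.T\<^sub>2 \<Gamma> \<bullet> M.\<kappa> (?e \<odot> ?l) (M.T\<^sub>1 (?e \<odot> ?l))) \<bullet>
      (M.\<kappa> ?e ?l \<rhd> M.T\<^sub>1 (M.T\<^sub>1 (?e \<odot> ?l))) \<bullet> ((?Te \<odot> ?Tl) \<lhd> k) =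
    (M.\<kappa> ?e ?l \<rhd> M.T\<^sub>1 (M.\<mu> ?X)) \<bullet> (?Te \<lhd> Q) \<bullet> (G \<rhd> (?TlS \<odot> ?TTl)) \<bullet> (?Te \<lhd> H \<rhd> ?TTl)"
    by (simp add: \<Gamma> Tb M.T.Map2_whisker M.T.Kap_Comp1_left k_def Q_def)
  let ?\<sigma> = "((?e \<odot> ?l) \<lhd> M.\<kappa> ?e ?l \<rhd> M.T\<^sub>1 (M.T\<^sub>1 (?e \<odot> ?l))) \<bullet> ((?e \<odot> ?l \<odot> ?Te \<odot> ?Tl) \<lhd> k)"
  have "?rhs \<bullet> ?\<sigma> = (\<Gamma> \<rhd> M.\<mu> (M.T\<^sub>0 ?X)) \<bullet> ((?e \<odot> ?l) \<lhd> M.\<mu>\<^sub>1 (?e \<odot> ?l)) \<bullet>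
      (((?e \<lhd> m ?X) \<bullet> (b \<rhd> ?Tl)) \<rhd> M.T\<^sub>1 (M.T\<^sub>1 (?e \<odot> ?l))) \<bullet> ((?e \<odot> ?l \<odot> ?Te \<odot> ?Tl) \<lhd> k)"
    unfolding \<Gamma>_def[symmetric] by (simp add: \<Gamma>)
  also have "(((?e \<lhd> m ?X) \<bullet> (b \<rhd> ?Tl)) \<rhd> M.T\<^sub>1 (M.T\<^sub>1 (?e \<odot> ?l))) \<bullet> ((?e \<odot> ?l \<odot> ?Te \<odot> ?Tl) \<lhd> k) =
      ((?e \<odot> ?l \<odot> M.\<mu> ?X) \<lhd> k) \<bullet> (((?e \<lhd> m ?X) \<bullet> (b \<rhd> ?Tl)) \<rhd> (?TTe \<odot> ?TTl))"
    by (rule M.whisker_exchange[symmetric]) simp_all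
  \<comment> \<open>\<mu> at the composite action splits into \<mu> at e' and at \<lambda>; its
    inverse compositor cancels the \<open>k\<close> just moved.\<close>
  also have "(\<Gamma> \<rhd> M.\<mu> (M.T\<^sub>0 ?X)) \<bullet> ((?e \<odot> ?l) \<lhd> M.\<mu>\<^sub>1 (?e \<odot> ?l)) \<bullet> \<dots> =
     (?e \<lhd> m ?X \<rhd> M.\<mu> (M.T\<^sub>0 ?X)) \<bullet> ((b \<rhd> (?Tl \<odot> M.\<mu> (M.T\<^sub>0 ?X))) \<bullet> ((?e \<odot> ?l \<odot> ?Te) \<lhd> M.\<mu>\<^sub>1 ?l)) \<bullet>
     (?e \<lhd> ?l \<lhd> M.\<mu>\<^sub>1 ?e \<rhd> ?TTl) \<bullet> (((?e \<lhd> m ?X) \<bullet> (b \<rhd> ?Tl)) \<rhd> (?TTe \<odot> ?TTl))"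
    by (simp add: \<Gamma> M.mu.Str_Comp1 k_def)
  also have "(b \<rhd> (?Tl \<odot> M.\<mu> (M.T\<^sub>0 ?X))) \<bullet> ((?e \<odot> ?l \<odot> ?Te) \<lhd> M.\<mu>\<^sub>1 ?l) =
      ((?e \<odot> M'.\<mu> ?X \<odot> ?lS) \<lhd> M.\<mu>\<^sub>1 ?l) \<bullet> (b \<rhd> (M.\<mu> ?SX \<odot> ?TTl))"
    by (rule M.whisker_exchange[symmetric]) simp_all
  also have "(?e \<lhd> m ?X \<rhd> M.\<mu> (M.T\<^sub>0 ?X)) \<bullet> \<dots> \<bullet>
     (?e \<lhd> ?l \<lhd> M.\<mu>\<^sub>1 ?e \<rhd> ?TTl) \<bullet> (((?e \<lhd> m ?X) \<bullet> (b \<rhd> ?Tl)) \<rhd> (?TTe \<odot> ?TTl)) =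
    (?e \<lhd> m ?X \<rhd> M.\<mu> (M.T\<^sub>0 ?X)) \<bullet> ((?e \<odot> M'.\<mu> ?X \<odot> ?lS) \<lhd> M.\<mu>\<^sub>1 ?l) \<bullet>
    (((b \<rhd> M.\<mu> ?SX) \<bullet> ((?e \<odot> ?l) \<lhd> M.\<mu>\<^sub>1 ?e) \<bullet> (?e \<lhd> (m ?X \<rhd> ?TTe)) \<bullet> (b \<rhd> (?Tl \<odot> ?TTe))) \<rhd> ?TTl)"
    by simp
  \<comment> \<open>The instance in which \<phi> and \<open>gB\<close> are both \<gamma>' and
    \<open>gA\<close> is a', so that \<open>bf\<close> and \<open>bB\<close> coincide with
    \<open>b\<close> and \<open>bA\<close> is \<open>c\<close>.\<close>
  also have "(b \<rhd> M.\<mu> ?SX) \<bullet> ((?e \<odot> ?l) \<lhd> M.\<mu>\<^sub>1 ?e) \<bullet> (?e \<lhd> (m ?X \<rhd> ?TTe)) \<bullet> (b \<rhd> (?Tl \<odot> ?TTe)) =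
    ((?e \<odot> M'.\<mu> ?X) \<lhd> m ?SX) \<bullet> (?e \<lhd> c \<rhd> ?TlS) \<bullet> (b \<rhd> (M.T\<^sub>1 (M'.\<mu> ?X) \<odot> ?TlS)) \<bullet>
    ((?e \<odot> ?l) \<lhd> G \<rhd> ?TlS) \<bullet> ((?e \<odot> ?l \<odot> ?Te) \<lhd> H)"
    unfolding b_def c_def G_def H_def by (rule restricted_assoc[OF _ _ _ _ _ _ A.alg_assoc_law]) simp_all
  also have "(?e \<lhd> m ?X \<rhd> M.\<mu> (M.T\<^sub>0 ?X)) \<bullet> ((?e \<odot> M'.\<mu> ?X \<odot> ?lS) \<lhd> M.\<mu>\<^sub>1 ?l) \<bullet> (\<dots> \<rhd> ?TTl) =
    (?e \<lhd> ((m ?X \<rhd> M.\<mu> (M.T\<^sub>0 ?X)) \<bullet> (M'.\<mu> ?X \<lhd> ((?lS \<lhd> M.\<mu>\<^sub>1 ?l) \<bullet> (m ?SX \<rhd> ?TTl))) \<bullet>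
      (M'.asc ?X \<rhd> (lam (M'.T\<^sub>0 ?SX) \<odot> ?TlS \<odot> ?TTl)))) \<bullet>
    (?e \<lhd> M'.\<mu> ?X \<lhd> lam\<^sub>1 (M'.\<mu> ?X) \<rhd> (?TlS \<odot> ?TTl)) \<bullet> (b \<rhd> (M.T\<^sub>1 (M'.\<mu> ?X) \<odot> ?TlS \<odot> ?TTl)) \<bullet>
    ((?e \<odot> ?l) \<lhd> G \<rhd> (?TlS \<odot> ?TTl)) \<bullet> ((?e \<odot> ?l \<odot> ?Te) \<lhd> H \<rhd> ?TTl)"
    by (simp add: c_def)
  also have "(m ?X \<rhd> M.\<mu> (M.T\<^sub>0 ?X)) \<bullet> (M'.\<mu> ?X \<lhd> ((?lS \<lhd> M.\<mu>\<^sub>1 ?l) \<bullet> (m ?SX \<rhd> ?TTl))) \<bullet>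
      (M'.asc ?X \<rhd> (lam (M'.T\<^sub>0 ?SX) \<odot> ?TlS \<odot> ?TTl)) =
    (?l \<lhd> M.asc ?X) \<bullet> (m ?X \<rhd> M.T\<^sub>1 (M.\<mu> ?X)) \<bullet>
    (M'.\<mu> ?X \<lhd> ((?lS \<lhd> Q) \<bullet> (inv2 (lam\<^sub>1 (M'.\<mu> ?X)) \<rhd> (?TlS \<odot> ?TTl))))"
    unfolding Q_def by (rule associativity_law[symmetric]) simp
  \<comment> \<open>The inverse of \<lambda> at \<mu>' from the associativity law cancels the
    remaining factor of \<open>c\<close>.\<close>
  also have "(?e \<lhd> \<dots>) \<bullet>
    (?e \<lhd> M'.\<mu> ?X \<lhd> lam\<^sub>1 (M'.\<mu> ?X) \<rhd> (?TlS \<odot> ?TTl)) \<bullet> (b \<rhd> (M.T\<^sub>1 (M'.\<mu> ?X) \<odot> ?TlS \<odot> ?TTl)) \<bullet>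
    ((?e \<odot> ?l) \<lhd> G \<rhd> (?TlS \<odot> ?TTl)) \<bullet> ((?e \<odot> ?l \<odot> ?Te) \<lhd> H \<rhd> ?TTl) =
    (?e \<lhd> ?l \<lhd> M.asc ?X) \<bullet> (?e \<lhd> m ?X \<rhd> M.T\<^sub>1 (M.\<mu> ?X)) \<bullet>
    (((?e \<odot> M'.\<mu> ?X \<odot> ?lS) \<lhd> Q) \<bullet> (b \<rhd> (M.T\<^sub>1 (M'.\<mu> ?X) \<odot> ?TlS \<odot> ?TTl))) \<bullet>
    ((?e \<odot> ?l) \<lhd> G \<rhd> (?TlS \<odot> ?TTl)) \<bullet> ((?e \<odot> ?l \<odot> ?Te) \<lhd> H \<rhd> ?TTl)"
    by simp
  also have "((?e \<odot> M'.\<mu> ?X \<odot> ?lS) \<lhd> Q) \<bullet> (b \<rhd> (M.T\<^sub>1 (M'.\<mu> ?X) \<odot> ?TlS \<odot> ?TTl)) =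
      (b \<rhd> (?Tl \<odot> M.T\<^sub>1 (M.\<mu> ?X))) \<bullet> ((?e \<odot> ?l \<odot> ?Te) \<lhd> Q)"
    by (rule M.whisker_exchange) simp_all
  also have "(?e \<lhd> ?l \<lhd> M.asc ?X) \<bullet> (?e \<lhd> m ?X \<rhd> M.T\<^sub>1 (M.\<mu> ?X)) \<bullet> \<dots> \<bullet>
    ((?e \<odot> ?l) \<lhd> G \<rhd> (?TlS \<odot> ?TTl)) \<bullet> ((?e \<odot> ?l \<odot> ?Te) \<lhd> H \<rhd> ?TTl) =
    (?e \<lhd> ?l \<lhd> M.asc ?X) \<bullet> (\<Gamma> \<rhd> M.T\<^sub>1 (M.\<mu> ?X)) \<bullet> ((?e \<odot> ?l) \<lhd>
      ((M.\<kappa> ?e ?l \<rhd> M.T\<^sub>1 (M.\<mu> ?X)) \<bullet> (?Te \<lhd> Q) \<bullet> (G \<rhd> (?TlS \<odot> ?TTl)) \<bullet> (?Te \<lhd> H \<rhd> ?TTl)))"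
    by (simp add: \<Gamma>)
  also have "\<dots> = ?lhs \<bullet> ?\<sigma>"
    unfolding T\<Gamma>[symmetric] \<Gamma>_def[symmetric] by simp
  finally have "?lhs \<bullet> ?\<sigma> = ?rhs \<bullet> ?\<sigma>" by simp
  then show ?thesis
    unfolding \<Gamma>_def[symmetric] by (rule M.VComp_cancel_right) simp_all
qed

lemma pseudoalgebra_restrict_alg:
  assumes "pseudoalgebra K M' A"
  shows "pseudoalgebra K M (restrict_alg A)"
proof -
  interpret A: pseudoalgebra K M' A by fact
  show ?thesis
  proof (unfold_locales, goal_cases)
    case 5
    then show ?case using restrict_alg_unit[OF assms] by simp
  next
    case 6
    then show ?case using restrict_alg_assoc[OF assms] by simp
  qed (simp_all add: M.hom1_ty M.iso2_ty restrict_alg_Gam[OF assms])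
qed

section \<open>Restricted morphisms and 2-cells\<close>

lemma restrict_morphism:
  assumes "pseudoalgebra_morphism K M' A B f \<phi>"
  shows "pseudoalgebra_morphism K M (restrict_alg A) (restrict_alg B) f
    ((\<phi> \<rhd> lam (Car A)) \<bullet> (Act B \<lhd> lam\<^sub>1 f))"
proof -
  interpret F: pseudoalgebra_morphism K M' A B f \<phi> by fact
  let ?X = "Car A" and ?Y = "Car B"
  let ?eA = "Act A" and ?eB = "Act B"
  let ?lX = "lam ?X" and ?lY = "lam ?Y"
  define b where "b = (\<phi> \<rhd> ?lX) \<bullet> (?eB \<lhd> lam\<^sub>1 f)"
  have [simp]: "M.ty2 b = bd (?eB \<odot> ?lY \<odot> M.T\<^sub>1 f) (f \<odot> ?eA \<odot> ?lX)" "M.invertible b"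
    by (simp_all add: b_def)
  interpret A: pseudoalgebra K M "restrict_alg A"
    by (rule pseudoalgebra_restrict_alg[OF F.A.pseudoalgebra_axioms])
  interpret B: pseudoalgebra K M "restrict_alg B"
    by (rule pseudoalgebra_restrict_alg[OF F.B.pseudoalgebra_axioms])
  show ?thesis
    unfolding b_def[symmetric]
  proof (unfold_locales, goal_cases)
    case 1
    then show ?case by (simp add: M.hom1_ty)
  next
    case 2
    then show ?case by (simp add: M.iso2_ty)
  next
    case 3
    \<comment> \<open>The restricted \<iota> of B begins with the inverse of u; precomposing with u
      removes it and prepares \<open>u_nat\<close>.\<close>
    let ?\<sigma> = "?eB \<lhd> (u ?Y \<rhd> f)"
    have "((f \<lhd> Iota (restrict_alg A)) \<bullet> (b \<rhd> M.\<eta> ?X) \<bullet> ((?eB \<odot> ?lY) \<lhd> M.\<eta>\<^sub>1 f)) \<bullet> ?\<sigma> =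
      (f \<lhd> Iota A) \<bullet> (f \<lhd> ?eA \<lhd> inv2 (u ?X)) \<bullet> (\<phi> \<rhd> (?lX \<odot> M.\<eta> ?X)) \<bullet>
      (?eB \<lhd> ((lam\<^sub>1 f \<rhd> M.\<eta> ?X) \<bullet> (?lY \<lhd> M.\<eta>\<^sub>1 f) \<bullet> (u ?Y \<rhd> f)))"
      by (simp add: b_def)
    also have "\<dots> = (f \<lhd> Iota A) \<bullet> (f \<lhd> ?eA \<lhd> inv2 (u ?X)) \<bullet> ((\<phi> \<rhd> (?lX \<odot> M.\<eta> ?X)) \<bullet>
      ((?eB \<odot> M'.T\<^sub>1 f) \<lhd> u ?X)) \<bullet> (?eB \<lhd> M'.\<eta>\<^sub>1 f)"
      by (subst u_nat[symmetric]) simp_all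
    also have "(\<phi> \<rhd> (?lX \<odot> M.\<eta> ?X)) \<bullet> ((?eB \<odot> M'.T\<^sub>1 f) \<lhd> u ?X) = ((f \<odot> ?eA) \<lhd> u ?X) \<bullet> (\<phi> \<rhd> M'.\<eta> ?X)"
      by (rule M.whisker_exchange[symmetric]) simp_all
    also have "(f \<lhd> Iota A) \<bullet> (f \<lhd> ?eA \<lhd> inv2 (u ?X)) \<bullet> \<dots> \<bullet> (?eB \<lhd> M'.\<eta>\<^sub>1 f) = Iota B \<rhd> f"
      by (simp add: F.mor_unit_law)
    also have "\<dots> = (Iota (restrict_alg B) \<rhd> f) \<bullet> ?\<sigma>" by simp
    finally have eq: "((f \<lhd> Iota (restrict_alg A)) \<bullet> (b \<rhd> M.\<eta> ?X) \<bullet> ((?eB \<odot> ?lY) \<lhd> M.\<eta>\<^sub>1 f)) \<bullet> ?\<sigma> =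
      (Iota (restrict_alg B) \<rhd> f) \<bullet> ?\<sigma>" .
    have "Iota (restrict_alg B) \<rhd> f =
        (f \<lhd> Iota (restrict_alg A)) \<bullet> (b \<rhd> M.\<eta> ?X) \<bullet> ((?eB \<odot> ?lY) \<lhd> M.\<eta>\<^sub>1 f)"
      by (rule M.VComp_cancel_right[OF eq[symmetric]]) simp_all
    then show ?case by (simp only: restrict_alg_sel(1,2))
  next
    case 4
    \<comment> \<open>One compositor suffices here: unlike the action of a restricted algebra, f is
      not a composite, so its iterated image needs no splitting.\<close>
    let ?\<sigma> = "(?eB \<odot> ?lY) \<lhd> M.\<kappa> ?eB ?lY \<rhd> M.T\<^sub>1 (M.T\<^sub>1 f)"
    define \<Gamma> where "\<Gamma> = Gam (restrict_alg A)"
    define \<Delta> where "\<Delta> = Gam (restrict_alg B)"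
    define bA where "bA = (Gam A \<rhd> lam (M'.T\<^sub>0 ?X)) \<bullet> (?eA \<lhd> lam\<^sub>1 ?eA)"
    define bB where "bB = (Gam B \<rhd> lam (M'.T\<^sub>0 ?Y)) \<bullet> (?eB \<lhd> lam\<^sub>1 ?eB)"
    define G where "G = inv2 (M.\<kappa> f ?eA) \<bullet> M.T\<^sub>2 \<phi> \<bullet> M.\<kappa> ?eB (M'.T\<^sub>1 f)"
    define H where "H = lam_hat f ?X ?Y"
    have [simp]: "M.ty2 bA = bd (?eA \<odot> ?lX \<odot> M.T\<^sub>1 ?eA) (?eA \<odot> M'.\<mu> ?X \<odot> lam (M'.T\<^sub>0 ?X))"
      "M.ty2 bB = bd (?eB \<odot> ?lY \<odot> M.T\<^sub>1 ?eB) (?eB \<odot> M'.\<mu> ?Y \<odot> lam (M'.T\<^sub>0 ?Y))"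
      "M.ty2 G = bd (M.T\<^sub>1 ?eB \<odot> M.T\<^sub>1 (M'.T\<^sub>1 f)) (M.T\<^sub>1 f \<odot> M.T\<^sub>1 ?eA)"
      "M.ty2 H = bd (M.T\<^sub>1 ?lY \<odot> M.T\<^sub>1 (M.T\<^sub>1 f)) (M.T\<^sub>1 (M'.T\<^sub>1 f) \<odot> M.T\<^sub>1 ?lX)"
      by (simp_all add: bA_def bB_def G_def H_def)
    have \<Gamma>: "\<Gamma> = (?eA \<lhd> m ?X) \<bullet> (bA \<rhd> M.T\<^sub>1 ?lX) \<bullet> ((?eA \<odot> ?lX) \<lhd> inv2 (M.\<kappa> ?eA ?lX))"
      unfolding \<Gamma>_def bA_def by (rule restrict_alg_Gam) (rule F.A.pseudoalgebra_axioms)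
    have \<Delta>: "\<Delta> = (?eB \<lhd> m ?Y) \<bullet> (bB \<rhd> M.T\<^sub>1 ?lY) \<bullet> ((?eB \<odot> ?lY) \<lhd> inv2 (M.\<kappa> ?eB ?lY))"
      unfolding \<Delta>_def bB_def by (rule restrict_alg_Gam) (rule F.B.pseudoalgebra_axioms)
    have Tb: "M.T\<^sub>2 b = M.\<kappa> f (?eA \<odot> ?lX) \<bullet> (M.T\<^sub>1 f \<lhd> M.\<kappa> ?eA ?lX) \<bullet> (G \<rhd> M.T\<^sub>1 ?lX) \<bullet> (M.T\<^sub>1 ?eB \<lhd> H) \<bullet>
        (inv2 (M.\<kappa> ?eB ?lY) \<rhd> M.T\<^sub>1 (M.T\<^sub>1 f)) \<bullet> inv2 (M.\<kappa> (?eB \<odot> ?lY) (M.T\<^sub>1 f))"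
      unfolding b_def G_def H_def by (rule T_restricted) simp_all
    have "((f \<lhd> \<Gamma>) \<bullet> (b \<rhd> M.T\<^sub>1 (?eA \<odot> ?lX)) \<bullet>
        ((?eB \<odot> ?lY) \<lhd> (inv2 (M.\<kappa> f (?eA \<odot> ?lX)) \<bullet> M.T\<^sub>2 b \<bullet> M.\<kappa> (?eB \<odot> ?lY) (M.T\<^sub>1 f)))) \<bullet> ?\<sigma> =
      (f \<lhd> \<Gamma>) \<bullet> ((b \<rhd> M.T\<^sub>1 (?eA \<odot> ?lX)) \<bullet> ((?eB \<odot> ?lY \<odot> M.T\<^sub>1 f) \<lhd> M.\<kappa> ?eA ?lX)) \<bullet>
        ((?eB \<odot> ?lY) \<lhd> G \<rhd> M.T\<^sub>1 ?lX) \<bullet> ((?eB \<odot> ?lY \<odot> M.T\<^sub>1 ?eB) \<lhd> H)"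
      by (simp add: \<Gamma> Tb)
    \<comment> \<open>Moves the compositor to the left of \<open>b\<close>, where it meets its
      inverse inside \<open>\<Gamma>\<close>.\<close>
    also have "(b \<rhd> M.T\<^sub>1 (?eA \<odot> ?lX)) \<bullet> ((?eB \<odot> ?lY \<odot> M.T\<^sub>1 f) \<lhd> M.\<kappa> ?eA ?lX) =
        ((f \<odot> ?eA \<odot> ?lX) \<lhd> M.\<kappa> ?eA ?lX) \<bullet> (b \<rhd> (M.T\<^sub>1 ?eA \<odot> M.T\<^sub>1 ?lX))"
      by (rule M.whisker_exchange[symmetric]) simp_all
    also have "(f \<lhd> \<Gamma>) \<bullet> \<dots> \<bullet> ((?eB \<odot> ?lY) \<lhd> G \<rhd> M.T\<^sub>1 ?lX) \<bullet> ((?eB \<odot> ?lY \<odot> M.T\<^sub>1 ?eB) \<lhd> H) =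
      ((f \<odot> ?eA) \<lhd> m ?X) \<bullet> (f \<lhd> bA \<rhd> M.T\<^sub>1 ?lX) \<bullet> (b \<rhd> (M.T\<^sub>1 ?eA \<odot> M.T\<^sub>1 ?lX)) \<bullet>
        ((?eB \<odot> ?lY) \<lhd> G \<rhd> M.T\<^sub>1 ?lX) \<bullet> ((?eB \<odot> ?lY \<odot> M.T\<^sub>1 ?eB) \<lhd> H)"
      by (simp add: \<Gamma>)
    also have "\<dots> = (b \<rhd> M.\<mu> ?X) \<bullet> ((?eB \<odot> ?lY) \<lhd> M.\<mu>\<^sub>1 f) \<bullet> (?eB \<lhd> (m ?Y \<rhd> M.T\<^sub>1 (M.T\<^sub>1 f))) \<bullet>
      (bB \<rhd> (M.T\<^sub>1 ?lY \<odot> M.T\<^sub>1 (M.T\<^sub>1 f)))"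
      unfolding b_def bA_def bB_def G_def H_def
      by (rule restricted_assoc[OF _ _ _ _ _ _ F.mor_assoc_law, symmetric]) simp_all
    also have "\<dots> = ((b \<rhd> M.\<mu> ?X) \<bullet> ((?eB \<odot> ?lY) \<lhd> M.\<mu>\<^sub>1 f) \<bullet> (\<Delta> \<rhd> M.T\<^sub>1 (M.T\<^sub>1 f))) \<bullet> ?\<sigma>"
      by (simp add: \<Delta>)
    finally have eq: "((f \<lhd> \<Gamma>) \<bullet> (b \<rhd> M.T\<^sub>1 (?eA \<odot> ?lX)) \<bullet>
        ((?eB \<odot> ?lY) \<lhd> (inv2 (M.\<kappa> f (?eA \<odot> ?lX)) \<bullet> M.T\<^sub>2 b \<bullet> M.\<kappa> (?eB \<odot> ?lY) (M.T\<^sub>1 f)))) \<bullet> ?\<sigma> =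
      ((b \<rhd> M.\<mu> ?X) \<bullet> ((?eB \<odot> ?lY) \<lhd> M.\<mu>\<^sub>1 f) \<bullet> (\<Delta> \<rhd> M.T\<^sub>1 (M.T\<^sub>1 f))) \<bullet> ?\<sigma>" .
    have "(f \<lhd> \<Gamma>) \<bullet> (b \<rhd> M.T\<^sub>1 (?eA \<odot> ?lX)) \<bullet>
        ((?eB \<odot> ?lY) \<lhd> (inv2 (M.\<kappa> f (?eA \<odot> ?lX)) \<bullet> M.T\<^sub>2 b \<bullet> M.\<kappa> (?eB \<odot> ?lY) (M.T\<^sub>1 f))) =
      (b \<rhd> M.\<mu> ?X) \<bullet> ((?eB \<odot> ?lY) \<lhd> M.\<mu>\<^sub>1 f) \<bullet> (\<Delta> \<rhd> M.T\<^sub>1 (M.T\<^sub>1 f))"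
      by (rule M.VComp_cancel_right[OF eq]) (simp_all add: \<Gamma> \<Delta>)
    then show ?case by (simp only: \<Gamma>_def \<Delta>_def restrict_alg_sel(1,2))
  qed
qed

lemma is_mor_restrict_mor: "M'.is_mor F \<Longrightarrow> M.is_mor (restrict_mor F)"
  by (simp add: pseudomonad_data.is_mor_def restrict_mor_def restrict_morphism)

lemma restrict_mor_sel [simp]:
  "MSrc (restrict_mor F) = restrict_alg (MSrc F)" "MTgt (restrict_mor F) = restrict_alg (MTgt F)"
  "MArr (restrict_mor F) = MArr F"
  "MCell (restrict_mor F) = (MCell F \<rhd> lam (Car (MSrc F))) \<bullet> (Act (MTgt F) \<lhd> lam\<^sub>1 (MArr F))"
  by (simp_all add: restrict_mor_def)

lemma restrict_mor_id_mor:
  assumes "pseudoalgebra K M' A"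
  shows "restrict_mor (M'.id_mor A) = M.id_mor (restrict_alg A)"
proof -
  interpret A: pseudoalgebra K M' A by fact
  show ?thesis
    by (intro psalg_mor.equality)
      (simp_all add: pseudomonad_data.id_mor_def lam.Str_Id1)
qed

text \<open>Strictness comes from \<lambda> being pseudonatural: the expansion of \<lambda> at the
  composite brings the compositor of T', which cancels its inverse in \<open>M'.comp_mor\<close>,
  and the inverse compositor of T that \<open>M.comp_mor\<close> requires.\<close>

lemma restrict_mor_comp_mor:
  assumes "M'.is_mor F" "M'.is_mor G" "MSrc G = MTgt F"
  shows "restrict_mor (M'.comp_mor G F) = M.comp_mor (restrict_mor G) (restrict_mor F)"
proof -
  note [simp] = M'.ty_psmor[OF assms(1)] M'.ty_psmor[OF assms(2), unfolded assms(3)] assms(3)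
  let ?f = "MArr F" and ?g = "MArr G" and ?X = "Car (MSrc F)" and ?Y = "Car (MTgt F)"
  let ?e = "Act (MTgt G)" and ?l = "lam (Car (MTgt G))"
  have "(MCell G \<rhd> (M'.T\<^sub>1 ?f \<odot> lam ?X)) \<bullet> ((?e \<odot> M'.T\<^sub>1 ?g) \<lhd> lam\<^sub>1 ?f) =
      ((?g \<odot> Act (MTgt F)) \<lhd> lam\<^sub>1 ?f) \<bullet> (MCell G \<rhd> (lam ?Y \<odot> M.T\<^sub>1 ?f))"
    by (rule M.whisker_exchange[symmetric]) simp_all
  then have "((MCell G \<rhd> (M'.T\<^sub>1 ?f \<odot> lam ?X)) \<bullet> ((?e \<odot> M'.T\<^sub>1 ?g) \<lhd> lam\<^sub>1 ?f)) \<bullet>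
     (?e \<lhd> lam\<^sub>1 ?g \<rhd> M.T\<^sub>1 ?f) \<bullet> (?e \<lhd> ?l \<lhd> inv2 (M.\<kappa> ?g ?f)) =
    (((?g \<odot> Act (MTgt F)) \<lhd> lam\<^sub>1 ?f) \<bullet> (MCell G \<rhd> (lam ?Y \<odot> M.T\<^sub>1 ?f))) \<bullet>
     (?e \<lhd> lam\<^sub>1 ?g \<rhd> M.T\<^sub>1 ?f) \<bullet> (?e \<lhd> ?l \<lhd> inv2 (M.\<kappa> ?g ?f))"
    by simp
  then show ?thesis
    by (intro psalg_mor.equality) (simp_all add: pseudomonad_data.comp_mor_def lam.Str_Comp1)
qed

text \<open>The condition on \<alpha> whiskered with \<lambda>, followed by naturality of \<lambda>
  at the underlying 2-cell.\<close>

lemma is_cell_restrict_cell: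
  assumes "M'.is_cell \<alpha>"
  shows "M.is_cell (restrict_cell \<alpha>)"
proof -
  note A = M'.is_cellD[OF assms]
  note [simp] = M'.ty_psmor[OF A(1)] M'.ty_psmor[OF A(2), unfolded A(3,4)] A(3-5)
  let ?f = "MArr (CDom \<alpha>)" and ?g = "MArr (CCod \<alpha>)" and ?a = "CCell \<alpha>"
  let ?\<phi> = "MCell (CDom \<alpha>)" and ?\<chi> = "MCell (CCod \<alpha>)"
  let ?eA = "Act (MSrc (CDom \<alpha>))" and ?eB = "Act (MTgt (CDom \<alpha>))"
  let ?lX = "lam (Car (MSrc (CDom \<alpha>)))" and ?lY = "lam (Car (MTgt (CDom \<alpha>)))"
  have "(?a \<rhd> (?eA \<odot> ?lX)) \<bullet> (?\<phi> \<rhd> ?lX) \<bullet> (?eB \<lhd> lam\<^sub>1 ?f) =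
      (((?a \<rhd> ?eA) \<bullet> ?\<phi>) \<rhd> ?lX) \<bullet> (?eB \<lhd> lam\<^sub>1 ?f)"
    by simp
  also have "\<dots> = (?\<chi> \<rhd> ?lX) \<bullet> (?eB \<lhd> ((M'.T\<^sub>2 ?a \<rhd> ?lX) \<bullet> lam\<^sub>1 ?f))"
    unfolding A(6) by simp
  also have "(M'.T\<^sub>2 ?a \<rhd> ?lX) \<bullet> lam\<^sub>1 ?f = lam\<^sub>1 ?g \<bullet> (?lY \<lhd> M.T\<^sub>2 ?a)"
    by (rule lam.Str_nat) simp_all
  finally show ?thesis
    using A(1,2) by (simp add: M.is_cell_def restrict_cell_def is_mor_restrict_mor M.hom2_ty)
qed

text \<open>\<open>restrict_cell\<close> keeps the underlying 2-cell, so the equations between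
  2-cells reduce to the strict preservation of identities and composites by
  \<open>restrict_mor\<close>.\<close>

lemma two_functor_restrict:
  "two_functor M'.pseudoalgebras M.pseudoalgebras restrict_alg restrict_mor restrict_cell"
proof -
  interpret C: two_category M'.pseudoalgebras by (rule M'.two_category_pseudoalgebras)
  interpret D: two_category M.pseudoalgebras by (rule M.two_category_pseudoalgebras)
  show ?thesis
    by unfold_locales (auto simp: hom1_def hom2_def pseudoalgebra_restrict_alg is_mor_restrict_mor
      is_cell_restrict_cell[unfolded restrict_cell_def] restrict_mor_id_mor restrict_mor_comp_mor
      restrict_cell_def
      M'.is_cellD(1-4))
qed

end

theorem theoremA7:
  fixes K :: "('o, 'm, 'c) two_cat"
    and M M' :: "('o, 'm, 'c) psmonad"
    and L :: "('o, 'm, 'c) psmonad_mor"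
  assumes "two_category K"
    and "pseudomonad K M" and "pseudomonad K M'"
    and "pseudomonad_morphism K M M' L"
  shows "(\<forall>A'. pseudoalgebra K M' A' \<longrightarrow>
            pseudoalgebra K M (pseudomonad_morphism_data.restrict_alg K M M' L A')) \<and>
         two_functor (pseudomonad_data.pseudoalgebras K M') (pseudomonad_data.pseudoalgebras K M)
           (pseudomonad_morphism_data.restrict_alg K M M' L)
           (pseudomonad_morphism_data.restrict_mor K M M' L)
           (pseudomonad_morphism_data.restrict_cell K M M' L)"
  using pseudomonad_morphism.pseudoalgebra_restrict_alg[OF assms(4)]
    pseudomonad_morphism.two_functor_restrict[OF assms(4)]
  by blast

end
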